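(* Let $v=12t$ where $t\ge 4$. Then there exists a $(v,3,2)$-BIBD $(X,\mathcal{A})$ that has a strong nesting $\phi:\mathcal{A}\to Y$, $X\subseteq Y$, with $|Y|=w=18t$, and this is optimal: no strong nesting of a $(v,3,2)$-BIBD uses fewer points.
   Context: A $(v,k,\lambda)$-BIBD is a pair $(X,\mathcal{A})$ where $X$ is a set of $v$ points and $\mathcal{A}$ is a multiset of $k$-subsets of $X$ (blocks) such that every pair of distinct points lies in exactly $\lambda$ blocks. Given a $(v,k,\lambda)$-BIBD $(X,\mathcal{A})$ and a set $Y\supseteq X$ with $|Y|=w$, a map $\phi:\mathcal{A}\to Y$ is a strong nesting if (1) $\phi(A)\notin A$ for every block $A\in\mathcal{A}$, and (2) the multiset of pairs $\{\{x,\phi(A)\}: A\in\mathcal{A},\ x\in A\}$ (one pair for each block $A$, counted with multiplicity in $\mathcal{A}$, and each $x\in A$) consists of distinct pairs. A strong nesting is optimal if $w=|Y|$ is as small as possible. *)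

theory Defs
  imports Main "HOL-Library.Multiset"
begin

definition is_bibd :: "'a set \<Rightarrow> 'a set multiset \<Rightarrow> nat \<Rightarrow> nat \<Rightarrow> nat \<Rightarrow> bool" where
  "is_bibd X A v k lam \<longleftrightarrow>
     finite X \<and> card X = v \<and>
     (\<forall>B \<in># A. B \<subseteq> X \<and> card B = k) \<and>
     (\<forall>x\<in>X. \<forall>y\<in>X. x \<noteq> y \<longrightarrow> size (filter_mset (\<lambda>B. x \<in> B \<and> y \<in> B) A) = lam)"

text \<open>The block multiset is given as an indexed family B over a finite index
set I (the multiset is image_mset B (mset_set I)), so that repeated blocks can
receive different nesting points. phi assigns to each block (copy) a point of Y.
Strong nesting: X is a subset of the finite set Y, phi i lies in Y and not in B i,
and the pairs {x, phi i} (i in I, x in B i) are pairwise distinct.\<close>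
definition strong_nesting ::
    "'a set \<Rightarrow> 'i set \<Rightarrow> ('i \<Rightarrow> 'a set) \<Rightarrow> 'a set \<Rightarrow> ('i \<Rightarrow> 'a) \<Rightarrow> bool" where
  "strong_nesting X I B Y phi \<longleftrightarrow>
     X \<subseteq> Y \<and> finite Y \<and>
     (\<forall>i\<in>I. phi i \<in> Y \<and> phi i \<notin> B i) \<and>
     inj_on (\<lambda>(i, x). {x, phi i}) (SIGMA i:I. B i)"

end

theory Submission
  imports Defs "HOL-Library.Disjoint_Sets" "HOL-Number_Theory.Number_Theory"
begin

text \<open>
  Lower bound: the \<open>v(v - 1)\<close> nested pairs are distinct and all meet \<open>X\<close>, so
  \<open>v(v - 1) \<le> v(v - 1)/2 + v(|Y| - v)\<close>, that is \<open>|Y| \<ge> (3v - 1)/2\<close>.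

  Existence: a block \<open>abc\<close> nested at \<open>w\<close> is a complete graph on four points, split into a star
  at \<open>w\<close> and a triangle. Give each side of the triangle one of two labels and require that the
  stars are edge-disjoint and that no labelled side occurs twice; since the number of blocks is
  the largest possible, each pair of points of \<open>X\<close> then lies in exactly two blocks. This turns
  the multiset condition into a packing condition, which is compatible with Wilson-type
  recursions. There is a version for groups of points, where the pairs within a group are not
  covered and the points of \<open>Y - X\<close> form an extra group. It can be inflated by a pair of
  orthogonal Latin squares, available for all orders \<open>4^i m\<close> with \<open>m\<close> odd, and its groups can be
  filled with smaller solutions. Induction on \<open>t\<close> then reduces everything to 4, 6, 8 or 9 groups
  of size 12, to \<open>m\<close> groups of size 12 or 24 with \<open>m\<close> coprime to 6, and to \<open>v = 12, 24, 36\<close>.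
  All of these are developed from base blocks that were found by computer search.
\<close>

text \<open>The labels lose nothing: two blocks share each pair of points, and their copies of that
  side can be labelled differently. A design with repeated pairs thus becomes a packing of simple
  graphs, which Latin squares can inflate.

  A count dictates the number of outer points, those of \<open>Y - X\<close>. With \<open>s\<close>
  groups of size \<open>g\<close> the stars have \<open>s(s-1)g^2\<close> edges, at most half of
  them inside \<open>X\<close>, so at least \<open>(s-1)g/2\<close> outer points are required:
  \<open>6(s-1)\<close> for \<open>g = 12\<close>. Packings that attain this use every admissible
  pair as a star edge. Inflation by \<open>r\<close> scales group size and outer points alike, and a
  filling adds \<open>g/2\<close> outer points, which makes \<open>sg/2\<close> in all. The slack
  left by rounding \<open>(3v-1)/2\<close> therefore sits in the fillings alone.

  The primes 2 and 3 shape the case distinction. No two Latin squares of order 2 are orthogonal, so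
  a single factor 2 of \<open>t\<close> cannot be an inflation factor; it moves into the number of
  groups (6 or 8) or into the group size (24). The uniform families need base differences that are
  units modulo the number of groups, so a factor 3 has to be split off as well.\<close>

section \<open>Quads and packings with groups\<close>

type_synonym 'p quad = "'p \<times> 'p \<times> 'p \<times> 'p \<times> bool \<times> bool \<times> bool"

text \<open>A quad \<open>(a, b, c, w, i, j, k)\<close> is the block \<open>abc\<close> nested at \<open>w\<close>, with labels \<open>i\<close>, \<open>j\<close>, \<open>k\<close> on
  the sides \<open>ab\<close>, \<open>ac\<close>, \<open>bc\<close>. Arcs with label \<open>None\<close> are those of the star at \<open>w\<close>.\<close>

definition arcs :: "'p quad \<Rightarrow> (bool option \<times> 'p \<times> 'p) set" where
  "arcs = (\<lambda>(a, b, c, w, i, j, k).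
     {(None, a, w), (None, b, w), (None, c, w), (None, w, a), (None, w, b), (None, w, c),
      (Some i, a, b), (Some j, a, c), (Some k, b, c), (Some i, b, a), (Some j, c, a), (Some k, c, b)})"

lemma arcs_iff:
  "x \<in> arcs (a, b, c, w, i, j, k) \<longleftrightarrow>
     x = (None, a, w) \<or> x = (None, b, w) \<or> x = (None, c, w) \<or>
     x = (None, w, a) \<or> x = (None, w, b) \<or> x = (None, w, c) \<or>
     x = (Some i, a, b) \<or> x = (Some j, a, c) \<or> x = (Some k, b, c) \<or>
     x = (Some i, b, a) \<or> x = (Some j, c, a) \<or> x = (Some k, c, b)"
  unfolding arcs_def prod.case insert_iff empty_iff simp_thms ..

text \<open>\<open>h\<close> assigns groups, and a quad has to be transversal to them. Only the
  centre \<open>w\<close> may be an outer point.\<close>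

definition proper :: "'p set \<Rightarrow> 'p set \<Rightarrow> ('p \<Rightarrow> 'g) \<Rightarrow> 'p quad \<Rightarrow> bool" where
  "proper X Y h = (\<lambda>(a, b, c, w, i, j, k). {a, b, c} \<subseteq> X \<and> w \<in> Y \<and>
     distinct [h a, h b, h c, h w])"

definition packing :: "'p set \<Rightarrow> 'p set \<Rightarrow> ('p \<Rightarrow> 'g) \<Rightarrow> 'p quad set \<Rightarrow> bool" where
  "packing X Y h Q \<longleftrightarrow> Ball Q (proper X Y h) \<and> disjoint_family_on arcs Q"

fun map_quad :: "('p \<Rightarrow> 'r) \<Rightarrow> 'p quad \<Rightarrow> 'r quad" where
  "map_quad f (a, b, c, w, i, j, k) = (f a, f b, f c, f w, i, j, k)"

lemma arcs_map_quad: "arcs (map_quad f e) = (\<lambda>(i, u, v). (i, f u, f v)) ` arcs e"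
  by (cases e) (simp only: arcs_def map_quad.simps prod.case image_insert image_empty)

lemma proper_mem: "proper X Y h (a, b, c, w, i, j, k) \<Longrightarrow> a \<in> X \<and> b \<in> X \<and> c \<in> X \<and> w \<in> Y"
  by (simp add: proper_def)

lemma proper_distinct: "proper X Y h (a, b, c, w, i, j, k) \<Longrightarrow> distinct [a, b, c, w]"
  by (auto simp: proper_def)

lemma arcs_subset:
  assumes "proper X Y h e" "X \<subseteq> Y" "(i, u, v) \<in> arcs e"
  shows "u \<in> Y" "v \<in> Y"
proof -
  obtain a b c w i1 i2 i3 where e: "e = (a, b, c, w, i1, i2, i3)" by (cases e)
  have "a \<in> Y \<and> b \<in> Y \<and> c \<in> Y \<and> w \<in> Y" using proper_mem[OF assms(1)[unfolded e]] assms(2) by blast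
  then show "u \<in> Y" "v \<in> Y" using assms(3) unfolding e arcs_iff by blast+
qed

lemma inj_on_map_quad:
  assumes "\<forall>e\<in>Q. proper X Y h e" "X \<subseteq> Y" "inj_on f Y"
  shows "inj_on (map_quad f) Q"
proof (rule inj_onI)
  fix e e' assume e: "e \<in> Q" "e' \<in> Q" "map_quad f e = map_quad f e'"
  obtain a b c w i j k where 1: "e = (a, b, c, w, i, j, k)" by (cases e)
  obtain a' b' c' w' i' j' k' where 2: "e' = (a', b', c', w', i', j', k')" by (cases e')
  have "a \<in> Y" "b \<in> Y" "c \<in> Y" "w \<in> Y" "a' \<in> Y" "b' \<in> Y" "c' \<in> Y" "w' \<in> Y"
    using proper_mem[OF bspec[OF assms(1) e(1), unfolded 1]]
      proper_mem[OF bspec[OF assms(1) e(2), unfolded 2]] assms(2)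
    by (simp_all add: subset_iff)
  then show "e = e'"
    using e(3) inj_on_eq_iff[OF assms(3)] by (simp add: 1 2)
qed

definition sides :: "'p quad \<Rightarrow> 'p set" where "sides = (\<lambda>(a, b, c, w, r). {a, b, c})"

definition centre :: "'p quad \<Rightarrow> 'p" where "centre = (\<lambda>(a, b, c, w, r). w)"

lemma proper_sides:
  assumes "proper X Y h e"
  shows "sides e \<subseteq> X" "card (sides e) = 3" "centre e \<in> Y" "centre e \<notin> sides e"
proof -
  obtain a b c w i j k where e: "e = (a, b, c, w, i, j, k)" by (cases e)
  show "sides e \<subseteq> X" "card (sides e) = 3" "centre e \<in> Y" "centre e \<notin> sides e"
    using proper_mem[OF assms[unfolded e]] proper_distinct[OF assms[unfolded e]]
    by (auto simp: e sides_def centre_def)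
qed

lemma star_arcs: "x \<in> sides e \<Longrightarrow> (None, x, centre e) \<in> arcs e \<and> (None, centre e, x) \<in> arcs e"
  by (cases e) (auto simp: sides_def centre_def arcs_iff)

lemma side_arcs:
  assumes "proper X Y h e" "x \<noteq> y"
  shows "x \<in> sides e \<and> y \<in> sides e \<longleftrightarrow> (\<exists>l. (Some l, x, y) \<in> arcs e)"
proof -
  obtain a b c w i j k where e: "e = (a, b, c, w, i, j, k)" by (cases e)
  have s: "sides e = {a, b, c}" by (simp add: e sides_def)
  have "\<exists>l. (Some l, x, y) \<in> arcs e" if "x \<in> {a, b, c}" "y \<in> {a, b, c}"
  proof -
    have "(Some i, x, y) \<in> arcs e \<or> (Some j, x, y) \<in> arcs e \<or> (Some k, x, y) \<in> arcs e"
      using that \<open>x \<noteq> y\<close> unfolding e arcs_iff by (elim insertE emptyE) simp_all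
    then show ?thesis by blast
  qed
  moreover have "x \<in> {a, b, c} \<and> y \<in> {a, b, c}" if "(Some l, x, y) \<in> arcs e" for l
    using that unfolding e arcs_iff by (elim disjE) simp_all
  ultimately show ?thesis unfolding s by blast
qed

text \<open>The six edges of a quad join different pairs of its four points. Hence the quads that
  cover a pair under the two labels are different, and the pair really lies in two blocks.\<close>

lemma arcs_label_unique:
  assumes "proper X Y h e" "(i, x, y) \<in> arcs e" "(j, x, y) \<in> arcs e"
  shows "i = j"
proof -
  obtain a b c w i1 i2 i3 where e: "e = (a, b, c, w, i1, i2, i3)" by (cases e)
  have d: "distinct [a, b, c, w]" using proper_distinct[OF assms(1)[unfolded e]] .
  show ?thesis using assms(2,3) d unfolding e arcs_iff by (elim disjE) simp_all
qed

lemma packingI: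
  assumes "\<And>e. e \<in> Q \<Longrightarrow> proper X Y h e"
    and "\<And>e e' i u v. e \<in> Q \<Longrightarrow> e' \<in> Q \<Longrightarrow> (i, u, v) \<in> arcs e \<Longrightarrow> (i, u, v) \<in> arcs e' \<Longrightarrow> e = e'"
  shows "packing X Y h Q"
  using assms unfolding packing_def disjoint_family_on_def by fast

lemma packing_proper: "packing X Y h Q \<Longrightarrow> e \<in> Q \<Longrightarrow> proper X Y h e"
  by (auto simp: packing_def)

lemma packing_disjointD:
  assumes "packing X Y h Q" "e \<in> Q" "e' \<in> Q" "x \<in> arcs e" "x \<in> arcs e'"
  shows "e = e'"
  using assms unfolding packing_def disjoint_family_on_def by blast

lemma proper_map:
  assumes "proper X Y h e" "X \<subseteq> Y" "f ` X \<subseteq> X'" "f ` Y \<subseteq> Y'"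
    and h: "\<And>x y. x \<in> Y \<Longrightarrow> y \<in> Y \<Longrightarrow> h x \<noteq> h y \<Longrightarrow> h' (f x) \<noteq> h' (f y)"
  shows "proper X' Y' h' (map_quad f e)"
proof -
  obtain a b c w i j k where e: "e = (a, b, c, w, i, j, k)" by (cases e)
  note p = assms(1)[unfolded e]
  have m: "a \<in> X" "b \<in> X" "c \<in> X" "a \<in> Y" "b \<in> Y" "c \<in> Y" "w \<in> Y"
    using proper_mem[OF p] \<open>X \<subseteq> Y\<close> by (simp_all add: subset_iff)
  then have "f a \<in> X'" "f b \<in> X'" "f c \<in> X'" "f w \<in> Y'"
    using assms(3,4) by (simp_all add: image_subset_iff)
  moreover have "distinct [h a, h b, h c, h w]" using p by (simp add: proper_def)
  then have "distinct [h' (f a), h' (f b), h' (f c), h' (f w)]"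
    using h m by simp
  ultimately show ?thesis
    by (simp only: e proper_def map_quad.simps prod.case insert_subset empty_subsetI simp_thms)
qed

lemma card_map_quad:
  assumes "packing X Y h Q" "X \<subseteq> Y" "inj_on f Y"
  shows "card (map_quad f ` Q) = card Q"
  using assms(1) unfolding packing_def by (intro card_image inj_on_map_quad[OF _ assms(2,3), of _ h]) blast

text \<open>The condition on \<open>h'\<close> is one-sided: \<open>f\<close> may split groups but
  not merge them. \<open>gdd_fill\<close> relies on this when it dissolves groups into single
  points.\<close>

lemma packing_map:
  assumes Q: "packing X Y h Q" and "X \<subseteq> Y" and inj: "inj_on f Y"
    and f: "f ` X \<subseteq> X'" "f ` Y \<subseteq> Y'"
      "\<And>x y. x \<in> Y \<Longrightarrow> y \<in> Y \<Longrightarrow> h x \<noteq> h y \<Longrightarrow> h' (f x) \<noteq> h' (f y)"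
  shows "packing X' Y' h' (map_quad f ` Q)"
proof (rule packingI)
    fix d assume "d \<in> map_quad f ` Q"
    then obtain e where "e \<in> Q" "d = map_quad f e" by blast
    then show "proper X' Y' h' d"
      using proper_map[where f = f and h = h and h' = h', OF packing_proper[OF Q] \<open>X \<subseteq> Y\<close> f] by simp
  next
    fix d d' i u v
    assume "d \<in> map_quad f ` Q" "d' \<in> map_quad f ` Q" and x: "(i, u, v) \<in> arcs d" "(i, u, v) \<in> arcs d'"
    then obtain e e' where e: "e \<in> Q" "e' \<in> Q" "d = map_quad f e" "d' = map_quad f e'" by blast
    obtain u1 v1 where 1: "(i, u1, v1) \<in> arcs e" "u = f u1" "v = f v1"
      using x(1) by (auto simp: arcs_map_quad e)
    obtain u2 v2 where 2: "(i, u2, v2) \<in> arcs e'" "u = f u2" "v = f v2"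
      using x(2) by (auto simp: arcs_map_quad e)
    have "u1 \<in> Y" "v1 \<in> Y" "u2 \<in> Y" "v2 \<in> Y"
      using arcs_subset[OF packing_proper[OF Q] \<open>X \<subseteq> Y\<close>] 1(1) 2(1) e by blast+
    then have "u1 = u2" "v1 = v2"
      using 1 2 inj by (auto dest: inj_onD)
    then show "d = d'" using packing_disjointD[OF Q] 1 2 e by metis
qed

lemma packing_Un:
  assumes "packing X Y h Q" "packing X Y h Q'"
    and "\<And>e e'. e \<in> Q \<Longrightarrow> e' \<in> Q' \<Longrightarrow> arcs e \<inter> arcs e' = {}"
  shows "packing X Y h (Q \<union> Q')"
  by (rule packingI) (use assms packing_proper packing_disjointD in \<open>blast+\<close>)

text \<open>The points are the \<open>(i, j)\<close> with \<open>i < s\<close>, where \<open>i\<close> is the group. The \<open>q\<close> points of group \<open>s\<close>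
  are those of \<open>Y - X\<close>.\<close>

definition gdd :: "nat \<Rightarrow> nat \<Rightarrow> nat \<Rightarrow> (nat \<times> nat) quad set \<Rightarrow> bool" where
  "gdd g s q Q \<longleftrightarrow>
     packing ({..<s} \<times> {..<g}) ({..<s} \<times> {..<g} \<union> {s} \<times> {..<q}) fst Q \<and>
     3 * card Q = s * (s - 1) * g\<^sup>2"

lemma finite_packing:
  assumes "packing X Y h Q" "finite X" "finite Y"
  shows "finite Q"
proof (rule finite_subset)
  show "Q \<subseteq> X \<times> X \<times> X \<times> Y \<times> UNIV"
  proof
    fix e assume "e \<in> Q"
    then have p: "proper X Y h e" using assms(1) by (auto simp: packing_def)
    obtain a b c w i j k where e: "e = (a, b, c, w, i, j, k)" by (cases e)
    show "e \<in> X \<times> X \<times> X \<times> Y \<times> UNIV"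
      using proper_mem[OF p[unfolded e]] by (simp add: e)
  qed
qed (use assms in simp)

lemma finite_gdd: "gdd g s q Q \<Longrightarrow> finite Q"
  unfolding gdd_def by (auto intro: finite_packing)

text \<open>Every pair is a triangle side once per label, because the number of quads is the
  largest that disjointness allows.\<close>

lemma packing_complete:
  assumes Q: "packing X Y h Q" and fin: "finite X" "finite Q"
    and c: "3 * card Q = card X * (card X - 1)"
    and xy: "x \<in> X" "y \<in> X" "x \<noteq> y"
  shows "\<exists>e\<in>Q. (Some l, x, y) \<in> arcs e"
proof -
  define D where "D = range (Some :: bool \<Rightarrow> _) \<times> (X \<times> X - Id_on X)"
  define T where "T e = arcs e \<inter> range Some \<times> UNIV" for e :: "'a quad"
  have "card (X \<times> X - Id_on X) = card X * (card X - 1)"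
  proof -
    have "Id_on X = (\<lambda>x. (x, x)) ` X" by auto
    then have "card (Id_on X) = card X" by (simp add: card_image inj_on_def)
    moreover have "Id_on X \<subseteq> X \<times> X" by auto
    ultimately show ?thesis
      using fin by (simp add: card_Diff_subset card_cartesian_product diff_mult_distrib2 finite_subset)
  qed
  moreover have "card (range (Some :: bool \<Rightarrow> _)) = 2"
    by (simp add: card_image)
  ultimately have D: "card D = 2 * (card X * (card X - 1))" "finite D"
    using fin by (simp_all add: D_def card_cartesian_product)
  have T: "card (T e) = 6 \<and> T e \<subseteq> D" if "e \<in> Q" for e
  proof -
    obtain a b c w i j k where e: "e = (a, b, c, w, i, j, k)" by (cases e)
    have p: "proper X Y h e" using Q that by (auto simp: packing_def)
    have "T e = {(Some i, a, b), (Some j, a, c), (Some k, b, c), (Some i, b, a), (Some j, c, a), (Some k, c, b)}"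
      by (simp add: T_def e arcs_def Int_insert_left)
    moreover have "a \<noteq> b" "a \<noteq> c" "b \<noteq> c" using proper_distinct[OF p[unfolded e]] by simp_all
    ultimately show ?thesis using proper_mem[OF p[unfolded e]] by (simp add: D_def Id_on_iff)
  qed
  have "card (\<Union>e\<in>Q. T e) = (\<Sum>e\<in>Q. card (T e))"
  proof (rule card_UN_disjoint)
    show "\<forall>e\<in>Q. \<forall>e'\<in>Q. e \<noteq> e' \<longrightarrow> T e \<inter> T e' = {}"
      using Q unfolding T_def packing_def disjoint_family_on_def by blast
    show "\<forall>e\<in>Q. finite (T e)" using T D(2) by (meson finite_subset)
  qed fact
  also have "\<dots> = 6 * card Q" using T by simp
  also have "\<dots> = card D" using c D by simp
  finally have "(\<Union>e\<in>Q. T e) = D"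
    using T D(2) by (intro card_subset_eq) blast+
  moreover have "(Some l, x, y) \<in> D" using xy by (auto simp: D_def)
  ultimately show ?thesis unfolding T_def by blast
qed

section \<open>From packings to strongly nested designs\<close>

lemma gdd_imp_bibd:
  assumes "gdd 1 v q Q"
  shows "\<exists>(X :: nat set) (I :: nat set) B Y phi.
            finite I \<and> is_bibd X (image_mset B (mset_set I)) v 3 2 \<and>
            strong_nesting X I B Y phi \<and> card Y = v + q"
proof -
  \<comment> \<open>Adding the coordinates sends \<open>(i, 0)\<close> to \<open>i\<close> and the
    outer point \<open>(v, j)\<close> to \<open>v + j\<close>.\<close>
  define f :: "nat \<times> nat \<Rightarrow> nat" where "f = (\<lambda>(i, j). i + j)"
  define R where "R = map_quad f ` Q"
  have Q: "packing ({..<v} \<times> {..<1}) ({..<v} \<times> {..<1} \<union> {v} \<times> {..<q}) fst Q" "3 * card Q = v * (v - 1)"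
    using assms by (simp_all add: gdd_def)
  have inj: "inj_on f ({..<v} \<times> {..<1} \<union> {v} \<times> {..<q})"
    by (auto simp: inj_on_def f_def)
  have "card R = card Q"
    unfolding R_def by (rule card_map_quad[OF Q(1) _ inj]) blast
  have pR: "packing {..<v} {..<v + q} id R"
    unfolding R_def by (rule packing_map[OF Q(1) _ inj]) (auto simp: f_def)
  have cR: "3 * card R = v * (v - 1)" using Q(2) \<open>card R = card Q\<close> by simp
  have fR: "finite R" using finite_gdd[OF assms] by (simp add: R_def)
  \<comment> \<open>The quads are enumerated, not the blocks: two quads may have the same triangle,
    and the index keeps such copies apart.\<close>
  then obtain d where d: "bij_betw d {..<card R} R"
    using ex_bij_betw_nat_finite[of R] by (auto simp: atLeast0LessThan)
  define I where "I = {..<card R}"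
  have dI: "d ` I = R" using d by (simp add: bij_betw_def I_def)
  have dR: "d i \<in> R" if "i \<in> I" for i using d that by (auto simp: bij_betw_def I_def)
  have dinj: "d i = d j \<Longrightarrow> i \<in> I \<Longrightarrow> j \<in> I \<Longrightarrow> i = j" for i j
    using d by (auto simp: bij_betw_def I_def inj_on_def)
  have pr: "proper {..<v} {..<v + q} id e" if "e \<in> R" for e using packing_proper[OF pR that] .
  have "is_bibd {..<v} (image_mset (\<lambda>i. sides (d i)) (mset_set I)) v 3 2"
    unfolding is_bibd_def
  proof (intro conjI ballI impI)
    fix B assume "B \<in># image_mset (\<lambda>i. sides (d i)) (mset_set I)"
    then obtain i where i: "i \<in> I" "B = sides (d i)" by (auto simp: I_def)
    then show "B \<subseteq> {..<v}" "card B = 3"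
      using proper_sides[OF pr[OF dR]] by simp_all
  next
    fix x y :: nat assume xy: "x \<in> {..<v}" "y \<in> {..<v}" "x \<noteq> y"
    let ?P = "\<lambda>e. x \<in> sides e \<and> y \<in> sides e"
    have "\<exists>e\<in>R. (Some l, x, y) \<in> arcs e" for l
      by (rule packing_complete[OF pR _ fR _ xy]; use cR in simp)
    then obtain e1 e2 where e: "e1 \<in> R" "e2 \<in> R" "(Some True, x, y) \<in> arcs e1" "(Some False, x, y) \<in> arcs e2"
      by blast
    have "?P e1" "?P e2"
      using side_arcs[OF pr xy(3)] e by blast+
    have "e1 \<noteq> e2"
    proof
      assume "e1 = e2"
      then have "(Some False, x, y) \<in> arcs e1" using e(4) by simp
      from arcs_label_unique[OF pr[OF e(1)] e(3) this] show False by simp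
    qed
    have "d = e1 \<or> d = e2" if d: "d \<in> R" "?P d" for d
    proof -
      obtain l where "(Some l, x, y) \<in> arcs d" using side_arcs[OF pr[OF d(1)] xy(3)] d(2) by blast
      then show ?thesis
        using packing_disjointD[OF pR d(1) e(1) _ e(3)] packing_disjointD[OF pR d(1) e(2) _ e(4)]
        by (cases l) simp_all
    qed
    then have "{e \<in> R. ?P e} = {e1, e2}" using e \<open>?P e1\<close> \<open>?P e2\<close> by blast
    moreover have "card {i \<in> I. ?P (d i)} = card {e \<in> R. ?P e}"
    proof -
      have "{e \<in> R. ?P e} = d ` {i \<in> I. ?P (d i)}"
        unfolding dI[symmetric] by blast
      moreover have "inj_on d {i \<in> I. ?P (d i)}"
        using dinj by (simp add: inj_on_def)
      ultimately show ?thesis by (simp add: card_image)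
    qed
    moreover have "size {#B \<in># image_mset (\<lambda>i. sides (d i)) (mset_set I). x \<in> B \<and> y \<in> B#} = card {i \<in> I. ?P (d i)}"
      by (simp add: filter_mset_image_mset I_def)
    ultimately show "size {#B \<in># image_mset (\<lambda>i. sides (d i)) (mset_set I). x \<in> B \<and> y \<in> B#} = 2"
      using \<open>e1 \<noteq> e2\<close> by simp
  qed auto
  moreover have "strong_nesting {..<v} I (\<lambda>i. sides (d i)) {..<v + q} (\<lambda>i. centre (d i))"
    unfolding strong_nesting_def
  proof (intro conjI ballI)
    fix i assume "i \<in> I"
    then show "centre (d i) \<in> {..<v + q}" "centre (d i) \<notin> sides (d i)"
      using proper_sides[OF pr[OF dR]] by auto
  next
    show "inj_on (\<lambda>(i, x). {x, centre (d i)}) (SIGMA i:I. sides (d i))"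
    proof (rule inj_onI, clarify)
      fix i x j y assume ij: "i \<in> I" "j \<in> I" "x \<in> sides (d i)" "y \<in> sides (d j)"
        and eq: "{x, centre (d i)} = {y, centre (d j)}"
      have "x = y \<and> centre (d i) = centre (d j) \<or> x = centre (d j) \<and> centre (d i) = y"
        using eq by (simp add: doubleton_eq_iff)
      \<comment> \<open>Equal unordered pairs may exchange a block point with a centre. A star
        contains both orientations of its edges, so either case yields an arc common to
        \<open>d i\<close> and \<open>d j\<close>.\<close>
      then have "(None, x, centre (d i)) \<in> arcs (d j)"
        using star_arcs[OF ij(4)] by (elim disjE conjE) simp_all
      then have "d i = d j"
        using packing_disjointD[OF pR dR[OF ij(1)] dR[OF ij(2)]] star_arcs[OF ij(3)] by blast
      moreover from this have "x = y" using eq by (auto simp: doubleton_eq_iff)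
      ultimately show "i = j \<and> x = y" using dinj ij by simp
    qed
  qed auto
  moreover have "finite I" "card {..<v + q} = v + q" by (simp_all add: I_def)
  ultimately show ?thesis
    by (intro exI[of _ "{..<v}"] exI[of _ I] exI[of _ "\<lambda>i. sides (d i)"] exI[of _ "{..<v + q}"]
        exI[of _ "\<lambda>i. centre (d i)"] conjI)
qed

section \<open>The lower bound\<close>

lemma card_off_diagonal:
  assumes "finite A"
  shows "card (A \<times> A - Id) = card A * (card A - 1)"
proof -
  have "A \<times> A - Id = A \<times> A - (\<lambda>x. (x, x)) ` A" by auto
  also have "card \<dots> = card (A \<times> A) - card ((\<lambda>x. (x, x)) ` A)"
    using assms by (intro card_Diff_subset) auto
  finally show ?thesis
    by (simp add: card_image inj_on_def card_cartesian_product diff_mult_distrib2)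
qed

lemma strong_nesting_lower_bound:
  fixes X :: "'a set" and I :: "'i set"
  assumes "finite I" and D: "is_bibd X (image_mset B (mset_set I)) v 3 2"
    and N: "strong_nesting X I B Y phi" and "v > 0"
  shows "3 * v \<le> 2 * card Y + 1"
proof -
  have X: "finite X" "card X = v" and B: "B i \<subseteq> X" "card (B i) = 3" if "i \<in> I" for i
    using D \<open>finite I\<close> that by (auto simp: is_bibd_def)
  have fX: "finite X" "card X = v" using D by (auto simp: is_bibd_def)
  have Y: "X \<subseteq> Y" "finite Y" using N by (auto simp: strong_nesting_def)
  define P where "P = X \<times> X - Id"
  have cP: "card P = v * (v - 1)" "finite P"
    using card_off_diagonal[of X] fX by (simp_all add: P_def)
  have two: "card {i \<in> I. fst p \<in> B i \<and> snd p \<in> B i} = 2" if "p \<in> P" for p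
  proof -
    have "fst p \<in> X" "snd p \<in> X" "fst p \<noteq> snd p" using that by (auto simp: P_def)
    then have "size {#A \<in># image_mset B (mset_set I). fst p \<in> A \<and> snd p \<in> A#} = 2"
      using D by (simp add: is_bibd_def)
    then show ?thesis using \<open>finite I\<close> by (simp add: filter_mset_image_mset)
  qed
  have six: "card {p \<in> P. fst p \<in> B i \<and> snd p \<in> B i} = 6" if i: "i \<in> I" for i
  proof -
    have "{p \<in> P. fst p \<in> B i \<and> snd p \<in> B i} = B i \<times> B i - Id"
      using B(1)[OF i] by (auto simp: P_def)
    moreover have "finite (B i)" using B(2)[OF i] by (simp add: card_ge_0_finite)
    ultimately show ?thesis using card_off_diagonal[of "B i"] B(2)[OF i] by simp
  qed
  \<comment> \<open>Counting incidences of ordered pairs with blocks in two ways determines the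
    number of blocks.\<close>
  have "6 * card I = (\<Sum>i\<in>I. card {p \<in> P. fst p \<in> B i \<and> snd p \<in> B i})"
    using six by simp
  also have "\<dots> = (\<Sum>p\<in>P. card {i \<in> I. fst p \<in> B i \<and> snd p \<in> B i})"
    using sum_multicount_gen[of I P "\<lambda>i p. fst p \<in> B i \<and> snd p \<in> B i"] \<open>finite I\<close> cP(2) by simp
  also have "\<dots> = 2 * (v * (v - 1))"
    using two cP by simp
  finally have I: "3 * card I = v * (v - 1)" by simp
  \<comment> \<open>\<open>E\<close> contains all unordered pairs that meet \<open>X\<close>, hence
    all nested pairs.\<close>
  define E where "E = {A. A \<subseteq> X \<and> card A = 2} \<union> (\<lambda>(x, y). {x, y}) ` (X \<times> (Y - X))"
  have "card (SIGMA i:I. B i) = 3 * card I"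
    using B(2) by (simp add: \<open>finite I\<close> card_ge_0_finite)
  moreover have "card (SIGMA i:I. B i) \<le> card E"
  proof (rule card_inj_on_le)
    show "inj_on (\<lambda>(i, x). {x, phi i}) (SIGMA i:I. B i)" using N by (simp add: strong_nesting_def)
    show "finite E" using fX Y by (auto simp: E_def)
    show "(\<lambda>(i, x). {x, phi i}) ` (SIGMA i:I. B i) \<subseteq> E"
    proof clarify
      fix i x assume i: "i \<in> I" "x \<in> B i"
      then have "x \<in> X" "phi i \<in> Y" "phi i \<noteq> x" using B(1) N by (auto simp: strong_nesting_def)
      then show "{x, phi i} \<in> E" by (cases "phi i \<in> X") (auto simp: E_def)
    qed
  qed
  moreover have "card E \<le> v * (v - 1) div 2 + v * (card Y - v)"
  proof -
    have "card E \<le> card {A. A \<subseteq> X \<and> card A = 2} + card ((\<lambda>(x, y). {x, y}) ` (X \<times> (Y - X)))"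
      unfolding E_def by (rule card_Un_le)
    also have "\<dots> \<le> (v choose 2) + card (X \<times> (Y - X))"
      using fX Y by (intro add_mono card_image_le) (simp_all add: n_subsets)
    finally show ?thesis
      using fX Y by (simp add: choose_two card_cartesian_product card_Diff_subset)
  qed
  ultimately have "v * (v - 1) \<le> v * (v - 1) div 2 + v * (card Y - v)"
    using I by simp
  then have "v * (v - 1) \<le> 2 * (v * (card Y - v))" by linarith
  then have "v * (v - 1) \<le> v * (2 * (card Y - v))" by (simp add: algebra_simps)
  then have "v - 1 \<le> 2 * (card Y - v)" using \<open>v > 0\<close> by simp
  moreover have "v \<le> card Y" using card_mono[OF Y(2,1)] fX by simp
  ultimately show ?thesis by simp
qed

section \<open>Inflation by orthogonal Latin squares\<close>

text \<open>An orthogonal array with the columns \<open>x\<close>, \<open>y\<close>,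
  \<open>f x y\<close>, \<open>h x y\<close>: rows that agree in two columns are equal. The five
  disjuncts are the pairs of columns other than the first two. Four columns match the four points of
  a quad, all of whose pairs are edges.\<close>

definition latin_pair :: "nat \<Rightarrow> (nat \<Rightarrow> nat \<Rightarrow> nat) \<Rightarrow> (nat \<Rightarrow> nat \<Rightarrow> nat) \<Rightarrow> bool" where
  "latin_pair r f h \<longleftrightarrow> (\<forall>x<r. \<forall>y<r. f x y < r \<and> h x y < r \<and>
     (\<forall>x'<r. \<forall>y'<r. x = x' \<and> f x y = f x' y' \<or> x = x' \<and> h x y = h x' y' \<or>
        y = y' \<and> f x y = f x' y' \<or> y = y' \<and> h x y = h x' y' \<or> f x y = f x' y' \<and> h x y = h x' y'
        \<longrightarrow> x = x' \<and> y = y'))"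

lemma latin_pairD:
  assumes "latin_pair r f h" "x < r" "y < r" "x' < r" "y' < r"
    "x = x' \<and> f x y = f x' y' \<or> x = x' \<and> h x y = h x' y' \<or>
     y = y' \<and> f x y = f x' y' \<or> y = y' \<and> h x y = h x' y' \<or> f x y = f x' y' \<and> h x y = h x' y'"
  shows "x = x' \<and> y = y'"
  using assms(1)[unfolded latin_pair_def, THEN spec, THEN mp, OF assms(2), THEN spec, THEN mp, OF assms(3),
      THEN conjunct2, THEN conjunct2, THEN spec, THEN mp, OF assms(4), THEN spec, THEN mp, OF assms(5), THEN mp, OF assms(6)] .

lemma arcs_separated:
  assumes "proper X Y h e" "(l, u, v) \<in> arcs e"
  shows "h u \<noteq> h v"
proof -
  obtain a b c w i j k where e: "e = (a, b, c, w, i, j, k)" by (cases e)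
  have "distinct [h a, h b, h c, h w]" using assms(1) by (simp add: e proper_def)
  then show ?thesis using assms(2) unfolding e arcs_iff by (elim disjE) auto
qed

lemma arcs_nonempty: "\<exists>l u v. (l, u, v) \<in> arcs e"
proof -
  obtain a b c w i j k where "e = (a, b, c, w, i, j, k)" by (cases e)
  then have "(None, a, w) \<in> arcs e" by (simp add: arcs_iff)
  then show ?thesis by blast
qed

text \<open>Each point gets \<open>r\<close> copies, and each quad is replaced by one quad per row
  of the array. Lifts that share an arc lie over the same quad and agree in two columns, hence come
  from the same row.\<close>

lemma gdd_inflate:
  assumes G: "gdd g s q Q" and L: "latin_pair r f h"
  shows "\<exists>Q'. gdd (g * r) s (q * r) Q'"
proof -
  define lift :: "(nat \<times> nat) quad \<Rightarrow> nat \<Rightarrow> nat \<Rightarrow> (nat \<times> nat) quad" where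
    "lift = (\<lambda>(a, b, c, w, l) x y. ((fst a, snd a * r + x), (fst b, snd b * r + y),
       (fst c, snd c * r + f x y), (fst w, snd w * r + h x y), l))"
  \<comment> \<open>Copy \<open>x\<close> of the point \<open>(i, j)\<close> is
    \<open>(i, j * r + x)\<close>; \<open>pr\<close> forgets the copy, and \<open>mod r\<close>
    recovers it.\<close>
  define pr :: "nat \<times> nat \<Rightarrow> nat \<times> nat" where "pr = (\<lambda>(i, j). (i, j div r))"
  define Q' where "Q' = (\<lambda>(e, x, y). lift e x y) ` (Q \<times> {..<r} \<times> {..<r})"
  let ?X = "\<lambda>g. {..<s} \<times> {..<g :: nat}" and ?Y = "\<lambda>g q. {..<s} \<times> {..<g :: nat} \<union> {s} \<times> {..<q :: nat}"
  have P: "packing (?X g) (?Y g q) fst Q" and cQ: "3 * card Q = s * (s - 1) * g\<^sup>2"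
    using G by (simp_all add: gdd_def)
  have fh: "f x y < r" "h x y < r" if "x < r" "y < r" for x y
    using L that by (simp_all add: latin_pair_def)
  have pr_lift: "map_quad pr (lift e x y) = e" if "x < r" "y < r" for e x y
    using that fh[OF that] by (cases e) (simp add: lift_def pr_def)
  have up: "i * r + x < n * r" if "i < n" "x < r" for i x n :: nat
  proof -
    have "i * r + x < Suc i * r" using that by simp
    also have "\<dots> \<le> n * r" using that by (intro mult_le_mono1) simp
    finally show ?thesis .
  qed
  have pl: "proper (?X (g * r)) (?Y (g * r) (q * r)) fst (lift e x y)"
    if "e \<in> Q" "x < r" "y < r" for e x y
  proof -
    obtain a b c w i j k where e: "e = (a, b, c, w, i, j, k)" by (cases e)
    have p: "proper (?X g) (?Y g q) fst e" by (rule packing_proper[OF P that(1)])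
    have m: "fst a < s" "snd a < g" "fst b < s" "snd b < g" "fst c < s" "snd c < g"
      "fst w < s \<and> snd w < g \<or> fst w = s \<and> snd w < q"
      using proper_mem[OF p[unfolded e]] by (simp_all add: mem_Times_iff)
    have d: "distinct [fst a, fst b, fst c, fst w]" using p by (simp add: e proper_def)
    have "snd a * r + x < g * r" "snd b * r + y < g * r" "snd c * r + f x y < g * r"
      using up m that fh[OF that(2,3)] by simp_all
    moreover have "fst w < s \<and> snd w * r + h x y < g * r \<or> fst w = s \<and> snd w * r + h x y < q * r"
      using m(7) up fh[OF that(2,3)] by blast
    ultimately show ?thesis
      using m d by (simp only: e lift_def prod.case proper_def fst_conv snd_conv Un_iff mem_Sigma_iff
          insert_subset empty_subsetI lessThan_iff singleton_iff simp_thms)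
  qed
  have eq: "e = e' \<and> x = x' \<and> y = y'"
    if e: "e \<in> Q" "e' \<in> Q" and xy: "x < r" "y < r" "x' < r" "y' < r"
      and arc: "(l, u, v) \<in> arcs (lift e x y)" "(l, u, v) \<in> arcs (lift e' x' y')"
    for e e' x y x' y' l u v
  proof -
    have "(l, pr u, pr v) \<in> arcs (map_quad pr (lift e x y))" "(l, pr u, pr v) \<in> arcs (map_quad pr (lift e' x' y'))"
      using imageI[OF arc(1), of "\<lambda>(i, u, v). (i, pr u, pr v)"]
        imageI[OF arc(2), of "\<lambda>(i, u, v). (i, pr u, pr v)"]
      by (simp_all add: arcs_map_quad)
    then have [simp]: "e' = e"
      using packing_disjointD[OF P e(2,1)] unfolding pr_lift[OF xy(1,2)] pr_lift[OF xy(3,4)] by blast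
    obtain a b c w i j k where e': "e = (a, b, c, w, i, j, k)" by (cases e)
    have d: "distinct [fst a, fst b, fst c, fst w]"
      using packing_proper[OF P e(1)] by (simp add: e' proper_def)
    \<comment> \<open>The four points of a quad lie in different groups, so the group of a point in
      \<open>S x y\<close> tells which column its copy number belongs to.\<close>
    define S where "S x y = {(fst a, x), (fst b, y), (fst c, f x y), (fst w, h x y)}" for x y
    have S: "(fst u, snd u mod r) \<in> S x y \<and> (fst v, snd v mod r) \<in> S x y"
      if "(l, u, v) \<in> arcs (lift e x y)" "x < r" "y < r" for x y
      using that(1) fh[OF that(2,3)] that(2,3) unfolding e' lift_def prod.case arcs_iff S_def
      by (elim disjE) simp_all
    have same: "fst z = fst a \<and> x = x' \<or> fst z = fst b \<and> y = y' \<or>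
        fst z = fst c \<and> f x y = f x' y' \<or> fst z = fst w \<and> h x y = h x' y'"
      if z: "(fst z, snd z mod r) \<in> S x y" "(fst z, snd z mod r) \<in> S x' y'" for z
      using z d unfolding S_def by (elim insertE emptyE) simp_all
    \<comment> \<open>The ends of an arc lie in different groups and therefore stand for two
      different columns in which the rows agree.\<close>
    have "fst u \<noteq> fst v" using arcs_separated[OF pl arc(1)] e xy by simp
    moreover have "(fst u, snd u mod r) \<in> S x y \<and> (fst v, snd v mod r) \<in> S x y"
      using S[OF arc(1) xy(1,2)] .
    moreover have "(fst u, snd u mod r) \<in> S x' y' \<and> (fst v, snd v mod r) \<in> S x' y'"
      using S[OF arc(2)[unfolded \<open>e' = e\<close>] xy(3,4)] .
    ultimately have "x = x' \<and> f x y = f x' y' \<or> x = x' \<and> h x y = h x' y' \<or>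
        y = y' \<and> f x y = f x' y' \<or> y = y' \<and> h x y = h x' y' \<or> f x y = f x' y' \<and> h x y = h x' y' \<or> x = x' \<and> y = y'"
      using same[of u] same[of v] by argo
    then show ?thesis using latin_pairD[OF L xy] \<open>e' = e\<close> by argo
  qed
  have "packing (?X (g * r)) (?Y (g * r) (q * r)) fst Q'"
  proof (rule packingI)
    fix d assume "d \<in> Q'"
    then show "proper (?X (g * r)) (?Y (g * r) (q * r)) fst d"
      using pl by (auto simp: Q'_def)
  next
    fix d d' l u v
    assume "d \<in> Q'" "d' \<in> Q'" and arc: "(l, u, v) \<in> arcs d" "(l, u, v) \<in> arcs d'"
    then obtain e x y e' x' y' where *: "e \<in> Q" "e' \<in> Q" "x < r" "y < r" "x' < r" "y' < r"
      "d = lift e x y" "d' = lift e' x' y'"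
      by (auto simp: Q'_def)
    show "d = d'" using eq[OF *(1-6) arc[unfolded *(7,8)]] by (simp add: *)
  qed
  moreover have "card Q' = card (Q \<times> {..<r} \<times> {..<r})"
    unfolding Q'_def
  proof (rule card_image, rule inj_onI)
    fix p p' assume p: "p \<in> Q \<times> {..<r} \<times> {..<r}" "p' \<in> Q \<times> {..<r} \<times> {..<r}"
      "(\<lambda>(e, x, y). lift e x y) p = (\<lambda>(e, x, y). lift e x y) p'"
    obtain e x y where 1: "p = (e, x, y)" by (cases p)
    obtain e' x' y' where 2: "p' = (e', x', y')" by (cases p')
    obtain l u v where "(l, u, v) \<in> arcs (lift e x y)"
      using arcs_nonempty[of "lift e x y"] by blast
    then show "p = p'"
      using eq[of e e' x y x' y' l u v] p by (simp add: 1 2)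
  qed
  then have "card Q' = card Q * r\<^sup>2"
    by (simp add: card_cartesian_product power2_eq_square)
  then have "3 * card Q' = s * (s - 1) * (g * r)\<^sup>2"
    using cQ by (metis mult.assoc power_mult_distrib)
  ultimately show ?thesis unfolding gdd_def by blast
qed

section \<open>Filling the groups\<close>

lemma arcs_image_map_quad:
  assumes "e \<in> map_quad f ` Q" "(l, u, v) \<in> arcs e"
  shows "\<exists>e0\<in>Q. \<exists>u0 v0. (l, u0, v0) \<in> arcs e0 \<and> u = f u0 \<and> v = f v0"
proof -
  obtain e0 where e0: "e0 \<in> Q" "e = map_quad f e0" using assms(1) by (rule imageE)
  have "\<exists>u0 v0. (l, u0, v0) \<in> arcs e0 \<and> u = f u0 \<and> v = f v0"
    using assms(2) unfolding e0(2) arcs_map_quad by auto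
  then show ?thesis using e0(1) by blast
qed

text \<open>Every group carries a copy of \<open>D\<close>, and all copies use the same
  \<open>q'\<close> new outer points. Sharing these is harmless, because a pair of a point in group
  \<open>n\<close> and a new point can occur only in copy \<open>n\<close>.\<close>

lemma gdd_fill:
  assumes G: "gdd g s q Q" and D: "gdd 1 g q' D" and "g > 0"
  shows "\<exists>Q'. gdd 1 (g * s) (q + q') Q'"
proof -
  let ?X = "{..<s} \<times> {..<g}" and ?Y = "{..<s} \<times> {..<g} \<union> {s} \<times> {..<q}"
  let ?X1 = "{..<g} \<times> {..<1 :: nat}" and ?Y1 = "{..<g} \<times> {..<1} \<union> {g} \<times> {..<q'}"
  let ?X' = "{..<g * s} \<times> {..<1 :: nat}" and ?Y' = "{..<g * s} \<times> {..<1} \<union> {g * s} \<times> {..<q + q'}"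
  define \<phi> where "\<phi> = (\<lambda>(i, j). if i < s then (i * g + j, 0) else (g * s, j))"
  \<comment> \<open>The new outer points are numbered after the \<open>q\<close> old ones,
    independently of \<open>n\<close>.\<close>
  define \<psi> where "\<psi> n = (\<lambda>(u, v). if u < g then (n * g + u, 0) else (g * s, q + v))" for n :: nat
  \<comment> \<open>\<open>\<kappa>\<close> recovers the old group, with \<open>s\<close> for old
    and \<open>s + 1\<close> for new outer points. Arcs of \<open>R\<close> join different classes
    up to \<open>s\<close>. Arcs of copy \<open>n\<close> have an end in class \<open>n\<close>, and
    the other end in class \<open>n\<close> or \<open>s + 1\<close>. This separates all the
    pieces.\<close>
  define \<kappa> where "\<kappa> = (\<lambda>(u, v). if u < g * s then u div g else if v < q then s else s + 1)"
  define R where "R = map_quad \<phi> ` Q"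
  define T where "T n = map_quad (\<psi> n) ` D" for n
  have P: "packing ?X ?Y fst Q" and cQ: "3 * card Q = s * (s - 1) * g\<^sup>2"
    using G by (simp_all add: gdd_def)
  have PD: "packing ?X1 ?Y1 fst D" and cD: "3 * card D = g * (g - 1)"
    using D by (simp_all add: gdd_def)
  have up: "i * g + x < g * s" if "i < s" "x < g" for i x
  proof -
    have "i * g + x < Suc i * g" using that by simp
    also have "\<dots> \<le> s * g" using that by (intro mult_le_mono1) simp
    finally show ?thesis by (simp add: mult.commute)
  qed
  have inj\<phi>: "inj_on \<phi> ?Y"
  proof (rule inj_onI)
    fix x y assume x: "x \<in> ?Y" "y \<in> ?Y" "\<phi> x = \<phi> y"
    obtain i j where xe: "x = (i, j)" by (cases x)
    obtain i' j' where ye: "y = (i', j')" by (cases y)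
    have "i < s \<and> j < g \<or> i = s \<and> j < q" "i' < s \<and> j' < g \<or> i' = s \<and> j' < q"
      using x by (simp_all add: xe ye)
    moreover have "i = i' \<and> j = j'" if "i * g + j = i' * g + j'" "j < g" "j' < g"
    proof -
      have "(i * g + j) div g = (i' * g + j') div g" "(i * g + j) mod g = (i' * g + j') mod g"
        using that(1) by simp_all
      then show ?thesis using that(2,3) by simp
    qed
    ultimately show "x = y"
      using x(3) up[of i j] up[of i' j'] by (auto simp: xe ye \<phi>_def)
  qed
  have \<phi>X: "\<phi> ` ?X \<subseteq> ?X'" "\<phi> ` ?Y \<subseteq> ?Y'"
    using up by (auto simp: \<phi>_def)
  have \<kappa>\<phi>: "\<kappa> (\<phi> x) = fst x" if "x \<in> ?Y" for x
    using that up by (cases x) (auto simp: \<phi>_def \<kappa>_def)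
  have inj\<psi>: "inj_on (\<psi> n) ?Y1" if "n < s" for n
  proof (rule inj_onI)
    fix x y assume x: "x \<in> ?Y1" "y \<in> ?Y1" "\<psi> n x = \<psi> n y"
    obtain i j where xe: "x = (i, j)" by (cases x)
    obtain i' j' where ye: "y = (i', j')" by (cases y)
    have "i < g \<and> j = 0 \<or> i = g \<and> j < q'" "i' < g \<and> j' = 0 \<or> i' = g \<and> j' < q'"
      using x by (simp_all add: xe ye)
    then show "x = y"
      using x(3) up[OF that, of i] up[OF that, of i'] by (auto simp: xe ye \<psi>_def)
  qed
  have \<psi>X: "\<psi> n ` ?X1 \<subseteq> ?X'" "\<psi> n ` ?Y1 \<subseteq> ?Y'" if "n < s" for n
    using up[OF that] by (auto simp: \<psi>_def)
  have \<kappa>\<psi>: "\<kappa> (\<psi> n x) = (if fst x < g then n else s + 1)" if "x \<in> ?Y1" "n < s" for x n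
    using that up[OF that(2)] by (cases x) (auto simp: \<psi>_def \<kappa>_def)
  have out: "fst z = s" if "z \<in> ?Y" "\<not> fst (\<phi> z) < g * s" for z
  proof (rule ccontr)
    assume "fst z \<noteq> s"
    then have "z \<in> ?X" using that(1) by auto
    then have "\<phi> z \<in> ?X'" using \<phi>X(1) by blast
    then show False using that(2) by auto
  qed
  have "fst (\<phi> x) \<noteq> fst (\<phi> y)" if "x \<in> ?Y" "y \<in> ?Y" "fst x \<noteq> fst y" for x y
  proof
    assume eq: "fst (\<phi> x) = fst (\<phi> y)"
    show False
    proof (cases "fst (\<phi> x) < g * s")
      case True
      then have "\<kappa> (\<phi> x) = \<kappa> (\<phi> y)"
        using eq by (simp add: \<kappa>_def case_prod_beta)
      then show False using \<kappa>\<phi> that by metis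
    next
      case False
      then have "fst x = s" "fst y = s"
        using out[OF that(1)] out[OF that(2)] eq by simp_all
      then show False using that(3) by simp
    qed
  qed
  then have PR: "packing ?X' ?Y' fst R"
    unfolding R_def by (intro packing_map[OF P _ inj\<phi> \<phi>X]) blast+
  have cR: "card R = card Q"
    unfolding R_def by (rule card_map_quad[OF P _ inj\<phi>]) blast
  have PT: "packing ?X' ?Y' fst (T n)" "card (T n) = card D" if n: "n < s" for n
  proof -
    have "fst (\<psi> n x) \<noteq> fst (\<psi> n y)" if "x \<in> ?Y1" "y \<in> ?Y1" "fst x \<noteq> fst y" for x y
    proof -
      have "fst (\<psi> n z) = n * g + fst z \<and> fst z < g \<and> n * g + fst z < g * s \<or> fst (\<psi> n z) = g * s \<and> fst z = g"
        if "z \<in> ?Y1" for z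
        using that up[OF n] by (cases z) (auto simp: \<psi>_def)
      from this[OF that(1)] this[OF that(2)] show ?thesis using that(3) by auto
    qed
    then show "packing ?X' ?Y' fst (T n)"
      unfolding T_def by (intro packing_map[OF PD _ inj\<psi>[OF n] \<psi>X[OF n]]) blast+
    show "card (T n) = card D"
      unfolding T_def by (rule card_map_quad[OF PD _ inj\<psi>[OF n]]) blast
  qed
  have arcR: "\<kappa> u \<noteq> \<kappa> v \<and> \<kappa> u \<le> s \<and> \<kappa> v \<le> s" if e: "e \<in> R" "(l, u, v) \<in> arcs e" for e l u v
  proof -
    obtain e0 u0 v0 where 0: "e0 \<in> Q" "(l, u0, v0) \<in> arcs e0" "u = \<phi> u0" "v = \<phi> v0"
      using arcs_image_map_quad[OF e[unfolded R_def]] by blast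
    have p: "proper ?X ?Y fst e0" by (rule packing_proper[OF P 0(1)])
    have "u0 \<in> ?Y" "v0 \<in> ?Y" using arcs_subset[OF p _ 0(2)] by blast+
    moreover have "fst u0 \<noteq> fst v0" by (rule arcs_separated[OF p 0(2)])
    ultimately show ?thesis using \<kappa>\<phi> unfolding 0(3,4) by auto
  qed
  have arcT: "(\<kappa> u = n \<or> \<kappa> v = n) \<and> {\<kappa> u, \<kappa> v} \<subseteq> {n, s + 1}"
    if e: "e \<in> T n" "(l, u, v) \<in> arcs e" and n: "n < s" for e l u v n
  proof -
    obtain e0 u0 v0 where 0: "e0 \<in> D" "(l, u0, v0) \<in> arcs e0" "u = \<psi> n u0" "v = \<psi> n v0"
      using arcs_image_map_quad[OF e[unfolded T_def]] by blast
    have p: "proper ?X1 ?Y1 fst e0" by (rule packing_proper[OF PD 0(1)])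
    have uv: "u0 \<in> ?Y1" "v0 \<in> ?Y1" using arcs_subset[OF p _ 0(2)] by blast+
    moreover have "fst u0 \<noteq> fst v0" by (rule arcs_separated[OF p 0(2)])
    ultimately have "fst u0 < g \<or> fst v0 < g" by auto
    then show ?thesis using \<kappa>\<psi>[OF uv(1) n] \<kappa>\<psi>[OF uv(2) n] unfolding 0(3,4) by auto
  qed
  have RT: "arcs e \<inter> arcs e' = {}" if "e \<in> R" "e' \<in> T n" "n < s" for e e' n
  proof -
    have False if "x \<in> arcs e" "x \<in> arcs e'" for x
    proof -
      obtain l u v where x: "x = (l, u, v)" by (cases x)
      show False using arcR[OF \<open>e \<in> R\<close> that(1)[unfolded x]] arcT[OF \<open>e' \<in> T n\<close> that(2)[unfolded x] \<open>n < s\<close>] by auto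
    qed
    then show ?thesis by blast
  qed
  have TT: "n = n'" if "e \<in> T n" "e' \<in> T n'" "n < s" "n' < s" "(l, u, v) \<in> arcs e" "(l, u, v) \<in> arcs e'" for e e' n n' l u v
    using arcT[OF that(1,5,3)] arcT[OF that(2,6,4)] that(3,4) by auto
  have PU: "packing ?X' ?Y' fst (\<Union>n<s. T n)"
  proof (rule packingI)
    fix e assume "e \<in> (\<Union>n<s. T n)"
    then show "proper ?X' ?Y' fst e" using packing_proper[OF PT(1)] by blast
  next
    fix e e' l u v assume e: "e \<in> (\<Union>n<s. T n)" "e' \<in> (\<Union>n<s. T n)"
      and arc: "(l, u, v) \<in> arcs e" "(l, u, v) \<in> arcs e'"
    obtain n n' where n: "e \<in> T n" "e' \<in> T n'" "n < s" "n' < s" using e by blast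
    then have "n = n'" using TT arc by blast
    then show "e = e'" using packing_disjointD[OF PT(1)[OF n(3)] n(1) _ arc] n by blast
  qed
  have "finite (T n)" for n using finite_gdd[OF D] by (simp add: T_def)
  moreover have "T n \<inter> T n' = {}" if "n < s" "n' < s" "n \<noteq> n'" for n n'
    using TT[of _ n _ n', OF _ _ that(1,2)] that(3) arcs_nonempty by (metis disjoint_iff)
  ultimately have "card (\<Union>n<s. T n) = (\<Sum>n<s. card (T n))"
    by (intro card_UN_disjoint) auto
  then have cU: "card (\<Union>n<s. T n) = s * card D" using PT(2) by simp
  have "e \<notin> T n" if "e \<in> R" "n < s" for e n
    using RT[OF that(1) _ that(2), of e] arcs_nonempty[of e] by blast
  then have "R \<inter> (\<Union>n<s. T n) = {}" by blast
  moreover have "finite R" "finite (\<Union>n<s. T n)"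
    using finite_gdd[OF G] finite_gdd[OF D] by (simp_all add: R_def T_def)
  ultimately have "card (R \<union> (\<Union>n<s. T n)) = card Q + s * card D"
    using cR cU by (simp add: card_Un_disjoint)
  then have "3 * card (R \<union> (\<Union>n<s. T n)) = s * (s - 1) * g\<^sup>2 + s * (g * (g - 1))"
    using cQ cD by (simp add: algebra_simps)
  also have "\<dots> = g * s * (g * s - 1)"
  proof (cases s)
    case (Suc m)
    obtain k where "g = Suc k" using \<open>g > 0\<close> by (cases g) auto
    then show ?thesis by (simp add: Suc power2_eq_square algebra_simps)
  qed simp
  finally have "3 * card (R \<union> (\<Union>n<s. T n)) = g * s * (g * s - 1)" .
  moreover have "packing ?X' ?Y' fst (R \<union> (\<Union>n<s. T n))"
    by (rule packing_Un[OF PR PU]) (use RT in blast)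
  ultimately show ?thesis unfolding gdd_def by auto
qed

section \<open>Developing base blocks over a cyclic product\<close>

text \<open>\<open>Inl\<close> is a point of \<open>\<int>\<^sub>N \<times> \<int>\<^sub>K\<close>, and \<open>Inr (n, r)\<close> is a point of \<open>Y - X\<close>. The group acts on the
  latter through \<open>\<int>\<^sub>K \<rightarrow> \<int>\<^sub>3\<close>, and \<open>orbit_code\<close> distinguishes the orbits of pairs of points.\<close>

type_synonym point = "(int \<times> int) + (nat \<times> int)"

fun shift :: "int \<Rightarrow> int \<Rightarrow> int \<times> int \<Rightarrow> point \<Rightarrow> point" where
  "shift N K (g, k) (Inl (x, z)) = Inl ((x + g) mod N, (z + k) mod K)"
| "shift N K (g, k) (Inr (n, r)) = Inr (n, (r + k) mod 3)"

text \<open>The first component is 0 for two inner points; otherwise it names the outer orbit, with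
  a sign for the end that is outer. The first coordinate acts trivially on outer points, so only a
  difference modulo 3 remains for mixed pairs. The last equation is a default value: every arc of a
  base block has an inner end.\<close>

fun orbit_code :: "int \<Rightarrow> int \<Rightarrow> point \<Rightarrow> point \<Rightarrow> int \<times> int \<times> int" where
  "orbit_code N K (Inl (x, z)) (Inl (x', z')) = (0, (x' - x) mod N, (z' - z) mod K)"
| "orbit_code N K (Inl (x, z)) (Inr (n, r)) = (int n + 1, 0, (r - z) mod 3)"
| "orbit_code N K (Inr (n, r)) (Inl (x, z)) = (- int n - 1, 0, (r - z) mod 3)"
| "orbit_code N K (Inr _) (Inr _) = (0, 0, 0)"

fun grp :: "int \<Rightarrow> point \<Rightarrow> int" where
  "grp S (Inl (x, z)) = x mod S"
| "grp S (Inr _) = S"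

definition base_pts :: "nat \<Rightarrow> point set" where
  "base_pts n = range Inl \<union> Inr ` ({..<n} \<times> {0})"

text \<open>Both orientations of an edge are arcs, so the condition also excludes a difference of
  order 2, for which some translation would reverse the edge.\<close>

definition distinct_orbits :: "int \<Rightarrow> int \<Rightarrow> point quad set \<Rightarrow> bool" where
  "distinct_orbits N K B \<longleftrightarrow> (\<forall>e\<in>B. \<forall>e'\<in>B. \<forall>l u v u' v'. (l, u, v) \<in> arcs e \<longrightarrow> (l, u', v') \<in> arcs e' \<longrightarrow>
     orbit_code N K u v = orbit_code N K u' v' \<longrightarrow> e = e' \<and> u = u' \<and> v = v')"

lemma orbit_code_shift:
  assumes "3 dvd K"
  shows "orbit_code N K (shift N K g u) (shift N K g v) = orbit_code N K u v"
proof -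
  have 3: "((r + k) mod 3 - (z + k) mod K) mod 3 = (r - z) mod 3" for r k z :: int
  proof -
    have "((r + k) mod 3 - (z + k) mod K) mod 3 = ((r + k) mod 3 - (z + k) mod K mod 3) mod 3"
      by (simp add: mod_diff_right_eq)
    also have "(z + k) mod K mod 3 = (z + k) mod 3" using assms by (rule mod_mod_cancel)
    finally show ?thesis by (simp add: mod_diff_eq)
  qed
  obtain g1 g2 where g: "g = (g1, g2)" by (cases g)
  show ?thesis
    by (cases "(N, K, u, v)" rule: orbit_code.cases) (auto simp: g 3 mod_diff_eq)
qed

text \<open>The action is free on inner points. It is not free on outer points, so a translation is
  always read off from the inner end of an arc.\<close>

lemma shift_inj:
  assumes "shift N K (g, k) (Inl p) = shift N K (g', k') (Inl p)"
    and "g \<in> {0..<N}" "k \<in> {0..<K}" "g' \<in> {0..<N}" "k' \<in> {0..<K}"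
  shows "g = g' \<and> k = k'"
proof -
  obtain x z where p: "p = (x, z)" by (cases p)
  have "(x + g) mod N = (x + g') mod N" "(z + k) mod K = (z + k') mod K"
    using assms(1) by (simp_all add: p)
  then have "(x + g - (x + g')) mod N = 0" "(z + k - (z + k')) mod K = 0"
    by (metis mod_eq_dvd_iff mod_0_imp_dvd dvd_imp_mod_0)+
  then have "g mod N = g' mod N" "k mod K = k' mod K"
    by (simp_all add: mod_eq_dvd_iff mod_eq_0_iff_dvd)
  then show ?thesis using assms(2-5) by simp
qed

lemma point_cases: "(\<exists>x z. u = Inl (x, z)) \<or> (\<exists>n r. u = Inr (n, r))" for u :: point
  by (cases u) auto

lemma grp_shift:
  assumes "S dvd N" "S > 0" "grp S u \<noteq> grp S v"
  shows "grp S (shift N K g u) \<noteq> grp S (shift N K g v)"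
proof -
  obtain g1 g2 where g: "g = (g1, g2)" by (cases g)
  have r: "(x + g1) mod N mod S = (x + g1) mod S" for x using assms(1) by (rule mod_mod_cancel)
  have e: "x mod S = y mod S" if "(x + g1) mod S = (y + g1) mod S" for x y
    using that by (simp add: mod_eq_dvd_iff)
  have lt: "x mod S \<noteq> S" for x using pos_mod_bound[OF assms(2), of x] by simp
  show ?thesis
    using assms(3) point_cases[of u] point_cases[of v]
    by (elim disjE exE) (auto simp: g r lt lt[symmetric] dest: e)
qed

text \<open>The method of differences: if translates of base quads share an arc, the orbit codes
  show that it comes from the same arc of the same base quad, and freeness shows that the
  translations agree.\<close>

lemma gdd_translate:
  fixes S m K n :: nat
  assumes pos: "S > 0" "m > 0" "K > 0" and "3 dvd K" and "finite B"
    and B: "\<And>e. e \<in> B \<Longrightarrow> proper (range Inl) (base_pts n) (grp S) e"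
    and orb: "distinct_orbits (int (S * m)) (int K) B"
    and cB: "3 * card B = (S - 1) * m * K"
  shows "\<exists>Q. gdd (m * K) S (3 * n) Q"
proof -
  define N where "N = int (S * m)"
  let ?G = "{0..<N} \<times> {0..<int K}"
  let ?X = "Inl ` ?G :: point set" and ?Y = "Inl ` ?G \<union> Inr ` ({..<n} \<times> {0..<3}) :: point set"
  define f where "f = (\<lambda>(e, g). map_quad (shift N K g) e)"
  define Q where "Q = f ` (B \<times> ?G)"
  have N: "N > 0" "int S dvd N" "N = int S * int m" using pos by (simp_all add: N_def)
  have K3: "(3::int) dvd int K" using \<open>3 dvd K\<close> by presburger
  have inl: "u \<in> range Inl \<or> v \<in> range Inl" if "e \<in> B" "(l, u, v) \<in> arcs e" for e l u v
  proof -
    obtain a b c w i j k where e: "e = (a, b, c, w, i, j, k)" by (cases e)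
    have "a \<in> range Inl \<and> b \<in> range Inl \<and> c \<in> range Inl"
      using proper_mem[OF B[OF that(1), unfolded e]] by simp
    then show ?thesis using that(2) unfolding e arcs_iff by (elim disjE) simp_all
  qed
  have eq: "e = e' \<and> g = g'"
    if e: "e \<in> B" "e' \<in> B" "g \<in> ?G" "g' \<in> ?G" "(l, u, v) \<in> arcs (f (e, g))" "(l, u, v) \<in> arcs (f (e', g'))"
    for e e' g g' l u v
  proof -
    obtain u0 v0 where 0: "(l, u0, v0) \<in> arcs e" "u = shift N K g u0" "v = shift N K g v0"
      using e(5) by (auto simp: f_def arcs_map_quad)
    obtain u1 v1 where 1: "(l, u1, v1) \<in> arcs e'" "u = shift N K g' u1" "v = shift N K g' v1"
      using e(6) by (auto simp: f_def arcs_map_quad)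
    have "orbit_code N K u0 v0 = orbit_code N K u1 v1"
      using 0 1 orbit_code_shift[OF K3] by metis
    then have s: "e = e'" "u0 = u1" "v0 = v1"
      using orb e(1,2) 0(1) 1(1) unfolding distinct_orbits_def N_def by blast+
    obtain p where "u0 = Inl p \<or> v0 = Inl p" using inl[OF e(1) 0(1)] by blast
    moreover have "shift N K g u0 = shift N K g' u0" "shift N K g v0 = shift N K g' v0"
      using 0 1 s by simp_all
    ultimately have "shift N K g (Inl p) = shift N K g' (Inl p)" by auto
    then have "g = g'"
      using shift_inj[of N K "fst g" "snd g" p "fst g'" "snd g'"] e(3,4) by (simp add: mem_Times_iff prod_eq_iff)
    then show ?thesis using s by simp
  qed
  have P: "packing ?X ?Y (grp S) Q"
  proof (rule packingI)
    fix d assume "d \<in> Q"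
    then obtain e g where d: "e \<in> B" "d = map_quad (shift N K g) e"
      by (auto simp: Q_def f_def)
    have r: "shift N K g (Inl p) \<in> ?X" for p
      using N(1) pos by (cases p; cases g) (auto intro!: imageI)
    have r': "shift N K g (Inr p) \<in> Inr ` ({..<n} \<times> {0..<3})" if "fst p < n" for p
      using that by (cases p; cases g) (auto intro!: imageI)
    show "proper ?X ?Y (grp S) d"
      unfolding d(2)
    proof (rule proper_map[OF B[OF d(1)]])
      show "shift N K g ` range Inl \<subseteq> ?X" using r by blast
      show "shift N K g ` base_pts n \<subseteq> ?Y" using r r' by (force simp: base_pts_def)
      show "grp S (shift N K g x) \<noteq> grp S (shift N K g y)" if "grp S x \<noteq> grp S y" for x y
        using grp_shift[OF N(2)] pos that by simp
    qed (simp add: base_pts_def)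
  next
    fix d d' l u v assume d: "d \<in> Q" "d' \<in> Q" "(l, u, v) \<in> arcs d" "(l, u, v) \<in> arcs d'"
    then obtain e g e' g' where *: "e \<in> B" "e' \<in> B" "g \<in> ?G" "g' \<in> ?G" "d = f (e, g)" "d' = f (e', g')"
      unfolding Q_def by blast
    show "d = d'" using eq[OF *(1-4) d(3,4)[unfolded *(5,6)]] by (simp add: *)
  qed
  have "inj_on f (B \<times> ?G)"
  proof (rule inj_onI)
    fix p p' assume p: "p \<in> B \<times> ?G" "p' \<in> B \<times> ?G" "f p = f p'"
    obtain e g where 1: "p = (e, g)" by (cases p)
    obtain e' g' where 2: "p' = (e', g')" by (cases p')
    obtain l u v where "(l, u, v) \<in> arcs (f (e, g))"
      using arcs_nonempty[of "f (e, g)"] by blast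
    then show "p = p'"
      using eq[of e e' g g' l u v] p by (simp add: 1 2)
  qed
  moreover have "card {0..<N} = S * m" by (simp add: N_def del: of_nat_mult)
  ultimately have cQ: "card Q = card B * (S * m * K)"
    unfolding Q_def by (simp add: card_image card_cartesian_product)
  \<comment> \<open>The residue of \<open>x\<close> modulo \<open>S\<close> is the group; within it,
    \<open>x div S\<close> and \<open>z\<close> are combined as digits with radix \<open>K\<close>.
    Each outer orbit consists of three points.\<close>
  define \<phi> :: "point \<Rightarrow> nat \<times> nat" where
    "\<phi> = case_sum (\<lambda>(x, z). (nat (x mod S), nat (x div S) * K + nat z)) (\<lambda>(n, r). (S, 3 * n + nat r))"
  have inj: "inj_on \<phi> ?Y"
  proof (rule inj_onI)
    fix u v assume uv: "u \<in> ?Y" "v \<in> ?Y" "\<phi> u = \<phi> v"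
    have small: "nat (x mod int S) < S" for x :: int using pos by (simp add: nat_less_iff)
    have dm: "a = a' \<and> k = k'" if "a * K + k = a' * K + k'" "k < K" "k' < K" for a a' k k' :: nat
    proof -
      have "(a * K + k) div K = (a' * K + k') div K" "(a * K + k) mod K = (a' * K + k') mod K"
        using that(1) by simp_all
      then show ?thesis using that(2,3) by simp
    qed
    have inner: "x = x' \<and> z = z'" if "0 \<le> x" "0 \<le> x'" "0 \<le> z" "0 \<le> z'" "z < K" "z' < K"
      "nat (x mod S) = nat (x' mod S)" "nat (x div S) * K + nat z = nat (x' div S) * K + nat z'" for x x' z z' :: int
    proof -
      have "nat (x div S) = nat (x' div S) \<and> nat z = nat z'"
        by (rule dm[OF that(8)]) (use that in \<open>simp_all add: nat_less_iff\<close>)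
      then have "x div S = x' div S" "z = z'" "x mod S = x' mod S"
        using that pos by (simp_all add: nat_eq_iff2 pos_imp_zdiv_nonneg_iff)
      then show ?thesis by (metis div_mult_mod_eq)
    qed
    have outer: "k = k' \<and> r = r'" if "3 * k + nat r = 3 * k' + nat r'" "0 \<le> r" "r < 3" "0 \<le> r'" "r' < 3" for k k' :: nat and r r' :: int
    proof -
      from that(2,4) obtain a b where ab: "r = int a" "r' = int b" by (metis nonneg_eq_int)
      then have "3 * k + a = 3 * k' + b" "a < 3" "b < 3" using that by simp_all
      then have "k = k' \<and> a = b" by presburger
      then show ?thesis by (simp add: ab)
    qed
    show "u = v"
    proof (cases u; cases v)
      fix p q assume "u = Inl p" "v = Inl q"
      then show ?thesis using uv inner[where x = "fst p" and x' = "fst q" and z = "snd p" and z' = "snd q"] by (cases p; cases q) (simp add: \<phi>_def image_iff)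
    next
      fix p q assume "u = Inr p" "v = Inr q"
      then show ?thesis using uv outer[where k = "fst p" and k' = "fst q" and r = "snd p" and r' = "snd q"] by (cases p; cases q) (simp add: \<phi>_def image_iff)
    next
      fix p q assume "u = Inl p" "v = Inr q"
      then show ?thesis using uv small[of "fst p"] by (cases p; cases q) (simp add: \<phi>_def)
    next
      fix p q assume "u = Inr p" "v = Inl q"
      then show ?thesis using uv small[of "fst q"] by (cases p; cases q) (simp add: \<phi>_def)
    qed
  qed
  have \<phi>X: "\<phi> ` ?X \<subseteq> {..<S} \<times> {..<m * K}"
  proof clarify
    fix i j x z assume x: "x \<in> {0..<N}" "z \<in> {0..<int K}" "(i, j) = \<phi> (Inl (x, z))"
    from x(1) obtain a where a: "x = int a" "a < S * m"
      by (metis N_def atLeastLessThan_iff nonneg_int_cases of_nat_less_iff)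
    have "nat (x div int S) < m"
      using a(2) less_mult_imp_div_less[of a m S] by (simp add: a(1) mult.commute flip: zdiv_int)
    then have "nat (x div int S) * K + nat z < Suc (nat (x div int S)) * K"
      using x(2) by (simp add: nat_less_iff)
    also have "\<dots> \<le> m * K" using \<open>nat (x div int S) < m\<close> by (intro mult_le_mono1) simp
    finally show "i \<in> {..<S} \<and> j \<in> {..<m * K}"
      using x pos by (simp add: \<phi>_def nat_less_iff)
  qed
  have "\<phi> ` (Inr ` ({..<n} \<times> {0..<3})) \<subseteq> {S} \<times> {..<3 * n}"
    by (auto simp: \<phi>_def)
  then have \<phi>Y: "\<phi> ` ?Y \<subseteq> {..<S} \<times> {..<m * K} \<union> {S} \<times> {..<3 * n}"
    using \<phi>X by blast
  have f\<phi>: "fst (\<phi> u) = nat (grp S u)" for u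
    using point_cases[of u] by (elim disjE exE) (simp_all add: \<phi>_def)
  have "grp S u \<ge> 0" for u
    using pos point_cases[of u] by (elim disjE exE) simp_all
  then have "fst (\<phi> u) \<noteq> fst (\<phi> v)" if "grp S u \<noteq> grp S v" for u v
    using that by (simp add: f\<phi> eq_nat_nat_iff)
  then have "packing ({..<S} \<times> {..<m * K}) ({..<S} \<times> {..<m * K} \<union> {S} \<times> {..<3 * n}) fst (map_quad \<phi> ` Q)"
    by (intro packing_map[OF P _ inj \<phi>X \<phi>Y]) blast+
  moreover have "card (map_quad \<phi> ` Q) = card Q"
    by (rule card_map_quad[OF P _ inj]) blast
  moreover have "3 * (card B * (S * m * K)) = S * (S - 1) * (m * K)\<^sup>2"
    using cB by (simp add: power2_eq_square algebra_simps)
  ultimately show ?thesis unfolding gdd_def using cQ by auto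
qed

section \<open>Checking base blocks by evaluation\<close>

definition arc_list :: "'p quad \<Rightarrow> (bool option \<times> 'p \<times> 'p) list" where
  "arc_list = (\<lambda>(a, b, c, w, i, j, k).
     [(None, a, w), (None, b, w), (None, c, w), (None, w, a), (None, w, b), (None, w, c),
      (Some i, a, b), (Some j, a, c), (Some k, b, c), (Some i, b, a), (Some j, c, a), (Some k, c, b)])"

lemma set_arc_list: "set (arc_list e) = arcs e"
  by (cases e) (simp only: arc_list_def arcs_def prod.case list.set)

lemma distinct_map_concat_inj:
  assumes "distinct (map f (concat (map g xs)))"
    and "e \<in> set xs" "e' \<in> set xs" "x \<in> set (g e)" "y \<in> set (g e')" "f x = f y"
  shows "e = e' \<and> x = y"
  using assms
proof (induction xs)
  case (Cons a xs)
  have d: "distinct (map f (g a))" "distinct (map f (concat (map g xs)))"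
    "f ` set (g a) \<inter> f ` (\<Union>e\<in>set xs. set (g e)) = {}"
    using Cons.prems(1) by simp_all
  have same: "x = y" if "x \<in> set (g a)" "y \<in> set (g a)"
    using d(1) that Cons.prems(6) by (auto simp: distinct_map inj_on_def)
  consider "e = a" "e' = a" | "e = a" "e' \<in> set xs" | "e \<in> set xs" "e' = a" | "e \<in> set xs" "e' \<in> set xs"
    using Cons.prems(2,3) by auto
  then show ?case
  proof cases
    case 1 then show ?thesis using same Cons.prems by simp
  next
    case 2
    then have "f x \<in> f ` set (g a)" "f y \<in> f ` (\<Union>e\<in>set xs. set (g e))"
      using Cons.prems(4,5) by blast+
    then show ?thesis using d(3) Cons.prems(6) by auto
  next
    case 3
    then have "f y \<in> f ` set (g a)" "f x \<in> f ` (\<Union>e\<in>set xs. set (g e))"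
      using Cons.prems(4,5) by blast+
    then show ?thesis using d(3) Cons.prems(6) by auto
  next
    case 4 then show ?thesis using Cons.IH[OF d(2) _ _ Cons.prems(4-6)] by blast
  qed
qed simp

lemma distinct_if_distinct_concat:
  assumes "distinct (concat (map g xs))" "\<And>x. g x \<noteq> []"
  shows "distinct xs"
  using assms
proof (induction xs)
  case (Cons x xs)
  have "hd (g x) \<in> set (g x)" by (rule hd_in_set[OF Cons.prems(2)])
  moreover have "distinct (g x @ concat (map g xs))" using Cons.prems(1) by simp
  ultimately have "x \<notin> set xs" "distinct (concat (map g xs))" by auto
  then show ?case using Cons.IH[OF _ Cons.prems(2)] by simp
qed simp

text \<open>The simplifier needs quadratic time for \<open>distinct\<close>, so long lists are split first.\<close>

fun distinct_split :: "('a \<Rightarrow> bool) list \<Rightarrow> 'a list \<Rightarrow> bool" where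
  "distinct_split [] xs \<longleftrightarrow> distinct xs"
| "distinct_split (p # ps) xs \<longleftrightarrow> distinct_split ps (filter p xs) \<and> distinct_split ps (filter (\<lambda>x. \<not> p x) xs)"

lemma distinct_filter_split: "distinct (filter p xs) \<Longrightarrow> distinct (filter (\<lambda>x. \<not> p x) xs) \<Longrightarrow> distinct xs"
  by (induction xs) (auto split: if_splits)

lemma distinct_split_imp_distinct: "distinct_split ps xs \<Longrightarrow> distinct xs"
proof (induction ps arbitrary: xs)
  case (Cons p ps)
  then have "distinct (filter p xs)" "distinct (filter (\<lambda>x. \<not> p x) xs)" by auto
  then show ?case by (rule distinct_filter_split)
qed simp

text \<open>Any list of tests is sound. These cut by label, by second difference and by ranges of
  the first difference, so that the remaining pieces are short.\<close>

definition code_tests :: "((bool option \<times> int \<times> int \<times> int) \<Rightarrow> bool) list" where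
  "code_tests = [\<lambda>(l, _). l = None, \<lambda>(l, _). l = Some True, \<lambda>(l, c, x, z). z = 0, \<lambda>(l, c, x, z). z = 1,
     \<lambda>(l, c, x, z). c = 0, \<lambda>(l, c, x, z). x < 8, \<lambda>(l, c, x, z). x < 16, \<lambda>(l, c, x, z). x < 24]"

type_synonym triple_code = "int \<times> int \<times> int \<times> int \<times> int \<times> int \<times> bool \<times> bool \<times> bool"

fun quad_of :: "point \<Rightarrow> triple_code \<Rightarrow> point quad" where
  "quad_of w (x, z, x', z', x'', z'', i, j, k) = (Inl (x, z), Inl (x', z'), Inl (x'', z''), w, i, j, k)"

text \<open>Translation brings every inner centre to the origin. Each outer orbit receives one base
  block, whose points then have to represent all residues modulo 3 in the second coordinate, or else
  two of its star edges would share a code.\<close>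

definition base_list :: "triple_code list \<Rightarrow> triple_code list \<Rightarrow> point quad list" where
  "base_list Is Os = map (quad_of (Inl (0, 0))) Is @ map2 (\<lambda>n. quad_of (Inr (n, 0))) [0..<length Os] Os"

text \<open>The additional 0 for inner blocks is the group of their centre
  \<open>Inl (0, 0)\<close>.\<close>

fun good_triple :: "int \<Rightarrow> bool \<Rightarrow> triple_code \<Rightarrow> bool" where
  "good_triple S b (x, z, x', z', x'', z'', _) \<longleftrightarrow>
     distinct ((if b then [0] else []) @ [x mod S, x' mod S, x'' mod S])"

lemma proper_quad_of:
  assumes "good_triple (int S) b t" "w = (if b then Inl (0, 0) else Inr (n, 0))" "b \<or> n < N" "S > 0"
  shows "proper (range Inl) (base_pts N) (grp S) (quad_of w t)"
proof -
  obtain x z x' z' x'' z'' i j k where t: "t = (x, z, x', z', x'', z'', i, j, k)"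
    by (metis surj_pair)
  have "a mod int S < int S" for a :: int
    by (rule pos_mod_bound) (use assms(4) in simp)
  then have "a mod int S \<noteq> int S" for a :: int
    by (metis less_irrefl)
  then show ?thesis
    using assms(1-3) by (cases b) (simp_all add: t proper_def base_pts_def)
qed

text \<open>Distinctness of one list of labelled codes carries everything: it gives
  \<open>distinct_orbits\<close>, and also that no base block is listed twice, so that lengths of
  lists count quads.\<close>

lemma gdd_of_lists:
  assumes pos: "S > 0" "m > 0" "K > 0" and "3 dvd K"
    and good: "list_all (good_triple (int S) True) Is" "list_all (good_triple (int S) False) Os"
    and split: "distinct_split code_tests (map (\<lambda>(l, u, v). (l, orbit_code (int (S * m)) (int K) u v))
      (concat (map arc_list (base_list Is Os))))"
    and len: "3 * (length Is + length Os) = (S - 1) * m * K"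
  shows "\<exists>Q. gdd (m * K) S (3 * length Os) Q"
proof (rule gdd_translate[OF pos \<open>3 dvd K\<close>, of "set (base_list Is Os)"])
  note dist = distinct_split_imp_distinct[OF split]
  have "distinct (concat (map arc_list (base_list Is Os)))" using dist by (simp add: distinct_map)
  then have "distinct (base_list Is Os)"
    by (rule distinct_if_distinct_concat) (simp add: arc_list_def case_prod_beta)
  moreover have "length (base_list Is Os) = length Is + length Os" by (simp add: base_list_def)
  ultimately show "3 * card (set (base_list Is Os)) = (S - 1) * m * K"
    using len by (simp only: distinct_card)
  show "distinct_orbits (int (S * m)) (int K) (set (base_list Is Os))"
    unfolding distinct_orbits_def
  proof (intro ballI allI impI)
    fix e e' l u v u' v'
    assume "e \<in> set (base_list Is Os)" "e' \<in> set (base_list Is Os)" "(l, u, v) \<in> arcs e" "(l, u', v') \<in> arcs e'"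
      and "orbit_code (int (S * m)) (int K) u v = orbit_code (int (S * m)) (int K) u' v'"
    then have "e = e' \<and> (l, u, v) = (l, u', v')"
      by (intro distinct_map_concat_inj[OF dist]) (simp_all add: set_arc_list)
    then show "e = e' \<and> u = u' \<and> v = v'" by simp
  qed
  fix e assume "e \<in> set (base_list Is Os)"
  then consider t where "t \<in> set Is" "e = quad_of (Inl (0, 0)) t"
    | n where "n < length Os" "e = quad_of (Inr (n, 0)) (Os ! n)"
    unfolding base_list_def by (auto simp: set_zip)
  then show "proper (range Inl) (base_pts (length Os)) (grp S) e"
  proof cases
    case 1
    then show ?thesis
      using good(1) pos unfolding 1 by (intro proper_quad_of[of S True]) (simp_all add: list_all_iff)
  next
    case 2
    then show ?thesis
      using good(2) pos unfolding 2 by (intro proper_quad_of[of S False]) (simp_all add: list_all_iff)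
  qed
qed simp

section \<open>Four, six, eight and nine groups of size 12\<close>

text \<open>For \<open>s\<close> groups the points are those of \<open>Z_4s x Z_3\<close>, grouped
  by the first coordinate modulo \<open>s\<close>. The count requires \<open>4(s-1)\<close> base
  blocks. Half of them are outer ones, since each of these accounts for three of the
  \<open>6(s-1)\<close> outer points.\<close>

definition inner_4 :: "triple_code list" where
  "inner_4 = [(7, 1, 1, 2, 14, 1, True, True, True),
   (15, 0, 5, 0, 10, 0, True, True, False),
   (6, 1, 9, 1, 15, 2, True, True, True),
   (3, 0, 9, 0, 2, 0, False, True, False),
   (2, 1, 13, 2, 11, 2, True, False, True),
   (10, 1, 13, 1, 11, 1, False, False, False)]"

definition outer_4 :: "triple_code list" where
  "outer_4 = [(13, 2, 14, 0, 0, 1, True, True, True),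
   (5, 2, 0, 0, 14, 1, False, True, True),
   (1, 1, 0, 0, 3, 2, False, False, False),
   (5, 2, 0, 1, 10, 0, True, False, False),
   (10, 2, 0, 1, 9, 0, False, True, False),
   (6, 0, 4, 1, 3, 2, False, False, False)]"

lemma gdd_12_4: "\<exists>Q. gdd 12 4 18 Q"
proof -
  have "\<exists>Q. gdd (4 * 3) 4 (3 * length outer_4) Q"
    by (rule gdd_of_lists[where Is = inner_4]) (simp, simp, simp, simp, code_simp+)
  then show ?thesis by (simp add: outer_4_def)
qed

definition inner_6 :: "triple_code list" where
  "inner_6 = [(3, 1, 17, 2, 22, 1, True, True, True),
   (16, 1, 5, 1, 13, 1, True, True, True),
   (11, 0, 9, 0, 1, 0, True, True, False),
   (20, 2, 13, 2, 10, 0, True, False, True),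
   (8, 1, 16, 0, 7, 0, True, True, True),
   (22, 2, 23, 2, 21, 0, True, True, True),
   (23, 1, 20, 1, 9, 1, False, False, False),
   (4, 0, 2, 0, 19, 0, False, False, False),
   (14, 1, 19, 1, 15, 1, False, False, True),
   (7, 2, 3, 2, 10, 1, False, False, True)]"

definition outer_6 :: "triple_code list" where
  "outer_6 = [(15, 2, 17, 0, 8, 1, True, True, True),
   (4, 1, 1, 0, 5, 2, True, False, True),
   (4, 2, 17, 1, 12, 0, True, True, True),
   (20, 1, 4, 0, 0, 2, False, True, False),
   (8, 0, 11, 1, 21, 2, False, False, True),
   (2, 2, 0, 0, 13, 1, False, True, False),
   (5, 2, 4, 0, 12, 1, False, False, False),
   (3, 0, 20, 2, 5, 1, False, False, False),
   (10, 0, 6, 1, 1, 2, False, True, False),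
   (20, 0, 11, 2, 1, 1, False, False, False)]"

lemma gdd_12_6: "\<exists>Q. gdd 12 6 30 Q"
proof -
  have "\<exists>Q. gdd (4 * 3) 6 (3 * length outer_6) Q"
    by (rule gdd_of_lists[where Is = inner_6]) (simp, simp, simp, simp, code_simp+)
  then show ?thesis by (simp add: outer_6_def)
qed

definition inner_8 :: "triple_code list" where
  "inner_8 = [(29, 2, 28, 0, 7, 2, True, True, True),
   (5, 1, 2, 1, 6, 1, True, True, True),
   (26, 0, 23, 0, 21, 0, False, True, True),
   (2, 2, 20, 2, 14, 2, True, True, True),
   (12, 2, 1, 2, 19, 2, True, True, False),
   (3, 2, 15, 2, 10, 0, False, True, True),
   (5, 0, 6, 2, 31, 0, False, False, True),
   (18, 0, 27, 1, 13, 0, True, False, True),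
   (11, 2, 15, 1, 28, 2, True, True, True),
   (25, 0, 2, 0, 3, 0, True, False, False),
   (13, 2, 9, 2, 22, 2, False, False, True),
   (7, 1, 14, 1, 17, 0, False, True, True),
   (31, 2, 10, 2, 20, 0, False, False, True),
   (11, 1, 9, 1, 28, 1, False, False, False)]"

definition outer_8 :: "triple_code list" where
  "outer_8 = [(11, 2, 5, 0, 23, 1, True, True, True),
   (25, 2, 28, 0, 0, 1, True, False, True),
   (6, 1, 16, 2, 20, 0, False, False, False),
   (21, 1, 14, 0, 8, 2, False, True, True),
   (7, 0, 12, 1, 24, 2, True, True, True),
   (23, 2, 12, 1, 24, 0, True, True, False),
   (27, 0, 29, 1, 10, 2, True, True, False),
   (24, 0, 22, 1, 27, 2, True, False, False),
   (30, 0, 28, 2, 25, 1, False, False, False),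
   (15, 2, 3, 1, 29, 0, False, False, False),
   (17, 2, 16, 1, 26, 0, False, False, False),
   (30, 2, 13, 1, 26, 0, False, False, False),
   (21, 2, 6, 1, 15, 0, False, False, True),
   (24, 2, 1, 1, 3, 0, False, False, False)]"

lemma gdd_12_8: "\<exists>Q. gdd 12 8 42 Q"
proof -
  have "\<exists>Q. gdd (4 * 3) 8 (3 * length outer_8) Q"
    by (rule gdd_of_lists[where Is = inner_8]) (simp, simp, simp, simp, code_simp+)
  then show ?thesis by (simp add: outer_8_def)
qed

definition inner_9 :: "triple_code list" where
  "inner_9 = [(6, 2, 34, 0, 29, 2, True, True, True),
   (14, 1, 2, 1, 15, 2, True, True, True),
   (11, 0, 19, 0, 25, 2, True, True, True),
   (35, 1, 1, 0, 16, 0, True, True, True),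
   (25, 1, 29, 0, 28, 1, True, True, True),
   (15, 1, 10, 2, 22, 1, True, True, True),
   (31, 2, 5, 2, 12, 0, True, True, True),
   (32, 2, 4, 2, 35, 2, False, False, True),
   (3, 2, 6, 1, 10, 1, True, True, True),
   (3, 1, 16, 1, 17, 1, False, True, True),
   (31, 0, 30, 0, 14, 0, False, True, True),
   (19, 1, 8, 1, 24, 1, True, False, False),
   (3, 0, 13, 0, 15, 0, False, False, True),
   (7, 2, 13, 2, 24, 2, True, False, False),
   (34, 1, 20, 1, 13, 1, False, False, False),
   (8, 0, 4, 0, 10, 0, False, False, False)]"

definition outer_9 :: "triple_code list" where
  "outer_9 = [(6, 0, 8, 1, 3, 2, True, True, False),
   (2, 1, 24, 2, 18, 0, False, True, False),
   (5, 2, 20, 1, 30, 0, True, True, True),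
   (25, 2, 6, 1, 0, 0, False, True, True),
   (10, 1, 18, 2, 23, 0, True, True, False),
   (25, 0, 19, 2, 5, 1, False, True, True),
   (12, 1, 9, 2, 32, 0, False, False, False),
   (24, 2, 22, 1, 12, 0, False, False, True),
   (31, 1, 19, 0, 35, 2, True, True, False),
   (21, 0, 33, 1, 11, 2, False, False, False),
   (24, 1, 22, 2, 21, 0, False, False, False),
   (9, 0, 8, 2, 1, 1, False, False, False),
   (8, 1, 12, 2, 33, 0, False, False, False),
   (34, 1, 13, 2, 21, 0, True, False, False),
   (10, 2, 6, 0, 31, 1, False, False, False),
   (31, 2, 12, 0, 2, 1, False, False, False)]"

lemma gdd_12_9: "\<exists>Q. gdd 12 9 48 Q"
proof -
  have "\<exists>Q. gdd (4 * 3) 9 (3 * length outer_9) Q"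
    by (rule gdd_of_lists[where Is = inner_9]) (simp, simp, simp, simp, code_simp+)
  then show ?thesis by (simp add: outer_9_def)
qed

section \<open>Any number of groups coprime to 6\<close>

text \<open>The base blocks are multiplied by \<open>k = 1, \<dots>, H\<close> in the first coordinate, where \<open>m = 2H + 1\<close>.
  If \<open>\<bar>s\<bar>\<close> depends only on the second coordinate and on the label, and \<open>s\<close> is a unit modulo \<open>m\<close>,
  then the two slopes \<open>\<plusminus>s\<close> give each nonzero difference \<open>\<plusminus>sk\<close> once. Divisors of 36 are units
  for every \<open>m\<close> coprime to 6.\<close>

fun scale :: "nat \<Rightarrow> nat \<Rightarrow> point \<Rightarrow> point" where
  "scale H k (Inl (x, z)) = Inl (x * int k, z)"
| "scale H k (Inr (n, r)) = Inr (n * H + (k - 1), r)"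

fun slope_ok :: "(bool option \<Rightarrow> int \<Rightarrow> int) \<Rightarrow> bool option \<times> int \<times> int \<times> int \<Rightarrow> bool" where
  "slope_ok tab (l, c, s, z) \<longleftrightarrow> c \<noteq> 0 \<or> \<bar>s\<bar> = tab l z \<and> s dvd 36"

lemma slope_cancel:
  fixes s k :: int
  assumes "int m dvd s * k" "s dvd 36" "coprime m 6"
  shows "int m dvd k"
proof -
  have "coprime (int m) 6" using assms(3) by (metis coprime_int_iff of_nat_numeral)
  then have "coprime (int m) (6 ^ 2)" by (metis coprime_power_right_iff)
  then have "coprime (int m) s"
    by (rule coprime_divisors[OF dvd_refl, rotated]) (use assms(2) in simp)
  then show ?thesis using assms(1) by (simp add: coprime_dvd_mult_right_iff)
qed

lemma fst_orbit_code_scale: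
  "fst (orbit_code N K (scale H k (Inl p)) (scale H k (Inl q))) = 0"
  "fst (orbit_code N K (scale H k (Inl p)) (scale H k (Inr t))) > 0"
  "fst (orbit_code N K (scale H k (Inr t)) (scale H k (Inl p))) < 0"
proof -
  obtain x z y w n r where e: "p = (x, z)" "q = (y, w)" "t = (n, r)" by (metis surj_pair)
  have "0 \<le> int (n * H + (k - 1))" by simp
  then show "fst (orbit_code N K (scale H k (Inl p)) (scale H k (Inl q))) = 0"
    "fst (orbit_code N K (scale H k (Inl p)) (scale H k (Inr t))) > 0"
    "fst (orbit_code N K (scale H k (Inr t)) (scale H k (Inl p))) < 0"
    by (simp_all add: e del: of_nat_add of_nat_mult)
qed

lemma orbit_code_scale_cases:
  fixes N K :: int and H k :: nat and u v :: point
  assumes "u \<in> range Inl \<or> v \<in> range Inl"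
  defines "c \<equiv> fst (orbit_code N K (scale H k u) (scale H k v))"
  shows "u \<in> range Inl \<and> v \<in> range Inl \<and> c = 0 \<or> u \<in> range Inl \<and> v \<notin> range Inl \<and> c > 0 \<or>
    u \<notin> range Inl \<and> v \<in> range Inl \<and> c < 0"
  using assms(1) unfolding c_def
  by (cases u; cases v) (simp_all add: fst_orbit_code_scale image_iff del: scale.simps)

text \<open>The modulus 0 in \<open>orbit_code 0\<close> leaves first differences as integers, so
  one finite check of slopes serves all \<open>m\<close>. The groups are the \<open>m\<close> values
  of the first coordinate. Each multiple \<open>k\<close> of an outer block gets an outer orbit of
  its own, numbered \<open>n * H + (k - 1)\<close>.\<close>

lemma gdd_linear:
  assumes m: "m = 2 * H + 1" "coprime m 6" "H > 0" and K: "K > 0" "3 dvd K"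
    and split: "distinct_split code_tests (map (\<lambda>(l, u, v). (l, orbit_code 0 (int K) u v))
      (concat (map arc_list (base_list Is Os))))"
    and slope: "list_all (slope_ok tab) (map (\<lambda>(l, u, v). (l, orbit_code 0 (int K) u v))
      (concat (map arc_list (base_list Is Os))))"
    and len: "3 * (length Is + length Os) = 2 * K"
  shows "\<exists>Q. gdd K m (3 * (length Os * H)) Q"
proof -
  define F where "F = set (base_list Is Os)"
  define f where "f = (\<lambda>(e, k). map_quad (scale H k) e)"
  define B where "B = f ` (F \<times> {1..H})"
  note dist = distinct_split_imp_distinct[OF split]
  have same: "e = e' \<and> u = u' \<and> v = v'"
    if "e \<in> F" "e' \<in> F" "(l, u, v) \<in> arcs e" "(l, u', v') \<in> arcs e'"
      "orbit_code 0 (int K) u v = orbit_code 0 (int K) u' v'" for e e' l u v u' v'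
  proof -
    have "e = e' \<and> (l, u, v) = (l, u', v')"
      using that by (intro distinct_map_concat_inj[OF dist]) (simp_all add: set_arc_list F_def)
    then show ?thesis by simp
  qed
  have slopeD: "\<bar>x' - x\<bar> = tab l ((z' - z) mod int K) \<and> (x' - x) dvd 36"
    if "e \<in> F" "(l, Inl (x, z), Inl (x', z')) \<in> arcs e" for e l x z x' z'
  proof -
    have "(l, Inl (x, z), Inl (x', z')) \<in> set (concat (map arc_list (base_list Is Os)))"
      using that unfolding F_def set_concat set_map image_image set_arc_list by blast
    then have "slope_ok tab (l, orbit_code 0 (int K) (Inl (x, z)) (Inl (x', z')))"
      using slope unfolding list_all_iff set_map by (metis (no_types, lifting) image_eqI case_prod_conv)
    then show ?thesis by simp
  qed
  have shape: "\<exists>a b c w i j k. e = (a, b, c, w, i, j, k) \<and> a \<in> range Inl \<and> b \<in> range Inl \<and> c \<in> range Inl \<and>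
      (w \<in> range Inl \<or> (\<exists>n<length Os. w = Inr (n, 0)))" if eF: "e \<in> F" for e
  proof -
    have q: "\<exists>a b c i j k. quad_of w t = (Inl a, Inl b, Inl c, w, i, j, k)" for w t
      by (cases "(w, t)" rule: quad_of.cases) auto
    consider t where "t \<in> set Is" "e = quad_of (Inl (0, 0)) t"
      | n where "n < length Os" "e = quad_of (Inr (n, 0)) (Os ! n)"
      using eF unfolding base_list_def F_def by (auto simp: set_zip)
    then show ?thesis
    proof cases
      case 1
      then show ?thesis using q[of "Inl (0, 0)" t] by fastforce
    next
      case 2
      then show ?thesis using q[of "Inr (n, 0)" "Os ! n"] by fastforce
    qed
  qed
  have inl: "u \<in> range Inl \<or> v \<in> range Inl" if eF: "e \<in> F" and arc: "(l, u, v) \<in> arcs e" for e l u v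
  proof -
    obtain a b c w i j k where e: "e = (a, b, c, w, i, j, k)" "a \<in> range Inl" "b \<in> range Inl" "c \<in> range Inl"
      using shape[OF eF] by blast
    show ?thesis using arc e(2-4) unfolding e(1) arcs_iff by (elim disjE) simp_all
  qed
  have lt: "0 < int k" "int k < int m" if "k \<in> {1..H}" for k using that m(1) by auto
  have eq: "e = e' \<and> u = u' \<and> v = v' \<and> k = k'"
    if e: "e \<in> F" "e' \<in> F" and k: "k \<in> {1..H}" "k' \<in> {1..H}"
      and arc: "(l, u, v) \<in> arcs e" "(l, u', v') \<in> arcs e'"
      and code: "orbit_code (int m) (int K) (scale H k u) (scale H k v) =
        orbit_code (int m) (int K) (scale H k' u') (scale H k' v')" for e e' k k' l u v u' v'
  proof -
    have idx: "n = n' \<and> k = k'" if "n * H + (k - 1) = n' * H + (k' - 1)" for n n'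
    proof -
      have "k - 1 < H" "k' - 1 < H" using k by auto
      then have "(n * H + (k - 1)) div H = n" "(n' * H + (k' - 1)) div H = n'"
        "(n * H + (k - 1)) mod H = k - 1" "(n' * H + (k' - 1)) mod H = k' - 1"
        using m(3) by simp_all
      then have "n = n'" "k - 1 = k' - 1" using that by simp_all
      then show ?thesis using k by auto
    qed
    have zero: "d = 0" if "int m dvd d" "\<bar>d\<bar> < int m" for d
      using that by (metis dvd_abs_iff zdvd_not_zless abs_ge_zero abs_eq_0_iff le_less zero_less_abs_iff)
    note kind = fst_orbit_code_scale[of "int m" "int K" H]
    have pair: "a \<in> range Inl \<or> (\<exists>n r. a = Inr (n, r))" for a :: point by (cases a) auto
    consider x z x' z' where "u = Inl (x, z)" "v = Inl (x', z')"
      | x z n r where "u = Inl (x, z)" "v = Inr (n, r)"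
      | x z n r where "u = Inr (n, r)" "v = Inl (x, z)"
      using inl[OF e(1) arc(1)] point_cases[of u] point_cases[of v] by blast
    then show ?thesis
    proof cases
      case 1
      have c0: "fst (orbit_code (int m) (int K) (scale H k' u') (scale H k' v')) = 0"
        unfolding code[symmetric] 1 by (rule kind)
      have "u' \<in> range Inl \<and> v' \<in> range Inl"
        using orbit_code_scale_cases[OF inl[OF e(2) arc(2)], of "int m" "int K" H k'] c0 by linarith
      then obtain y w y' w' where 2: "u' = Inl (y, w)" "v' = Inl (y', w')"
        by (metis rangeE surj_pair)
      have dz: "(z' - z) mod int K = (w' - w) mod int K"
        and "(x' * int k - x * int k) mod int m = (y' * int k' - y * int k') mod int m"
        using code by (simp_all add: 1 2)
      then have dvd: "int m dvd (x' - x) * int k - (y' - y) * int k'"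
        by (simp add: mod_eq_dvd_iff algebra_simps)
      have s: "\<bar>x' - x\<bar> = \<bar>y' - y\<bar>" "(x' - x) dvd 36"
        using slopeD[OF e(1) arc(1)[unfolded 1]] slopeD[OF e(2) arc(2)[unfolded 2]] dz by simp_all
      \<comment> \<open>Equal slopes give \<open>m\<close> dividing \<open>k - k'\<close>, hence
        \<open>k = k'\<close>. Opposite slopes give \<open>m\<close> dividing \<open>k + k'\<close>,
        which is impossible because \<open>0 < k + k' <= 2H = m - 1\<close>. For this reason the
        multipliers stop at \<open>H\<close>.\<close>
      then consider "x' - x = y' - y" | "x' - x = - (y' - y)" by linarith
      then show ?thesis
      proof cases
        case 3: 1
        have "int m dvd (x' - x) * (int k - int k')"
          using dvd unfolding 3[symmetric] right_diff_distrib .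
        then have "int m dvd int k - int k'" by (rule slope_cancel[OF _ s(2) m(2)])
        then have "int k - int k' = 0" by (rule zero) (use lt[OF k(1)] lt[OF k(2)] in linarith)
        moreover have "orbit_code 0 (int K) u v = orbit_code 0 (int K) u' v'"
          using 3 dz by (simp add: 1 2)
        ultimately show ?thesis using same[OF e arc] by simp
      next
        case 3: 2
        have y: "y' - y = - (x' - x)" using 3 by simp
        have "int m dvd (x' - x) * (int k + int k')"
          using dvd unfolding y by (simp add: algebra_simps)
        then have "int m dvd int k + int k'" by (rule slope_cancel[OF _ s(2) m(2)])
        moreover have "int k + int k' < int m" "0 < int k + int k'" using k m(1) by auto
        ultimately show ?thesis using zdvd_not_zless by blast
      qed
    next
      case 1: 2
      have c0: "fst (orbit_code (int m) (int K) (scale H k' u') (scale H k' v')) > 0"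
        unfolding code[symmetric] 1 by (rule kind)
      have "u' \<in> range Inl \<and> v' \<notin> range Inl"
        using orbit_code_scale_cases[OF inl[OF e(2) arc(2)], of "int m" "int K" H k'] c0 by linarith
      then obtain y w n' r' where 2: "u' = Inl (y, w)" "v' = Inr (n', r')"
        using pair[of v'] by (metis rangeE surj_pair)
      have *: "int (n * H + (k - 1)) = int (n' * H + (k' - 1))" "(r - z) mod 3 = (r' - w) mod 3"
        using code by (simp_all add: 1 2 del: of_nat_add of_nat_mult of_nat_eq_iff One_nat_def)
      have "n = n' \<and> k = k'" by (rule idx) (use *(1) in \<open>simp only: of_nat_eq_iff\<close>)
      with *(2) show ?thesis using same[OF e arc] by (simp add: 1 2)
    next
      case 1: 3
      have c0: "fst (orbit_code (int m) (int K) (scale H k' u') (scale H k' v')) < 0"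
        unfolding code[symmetric] 1 by (rule kind)
      have "v' \<in> range Inl \<and> u' \<notin> range Inl"
        using orbit_code_scale_cases[OF inl[OF e(2) arc(2)], of "int m" "int K" H k'] c0 by linarith
      then obtain y w n' r' where 2: "v' = Inl (y, w)" "u' = Inr (n', r')"
        using pair[of u'] by (metis rangeE surj_pair)
      have *: "int (n * H + (k - 1)) = int (n' * H + (k' - 1))" "(r - z) mod 3 = (r' - w) mod 3"
        using code by (simp_all add: 1 2 del: of_nat_add of_nat_mult of_nat_eq_iff One_nat_def)
      have "n = n' \<and> k = k'" by (rule idx) (use *(1) in \<open>simp only: of_nat_eq_iff\<close>)
      with *(2) show ?thesis using same[OF e arc] by (simp add: 1 2)
    qed
  qed
  have arcB: "\<exists>u0 v0. (l, u0, v0) \<in> arcs e \<and> u = scale H k u0 \<and> v = scale H k v0"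
    if "(l, u, v) \<in> arcs (f (e, k))" for e k l u v
    using arcs_image_map_quad[of "map_quad (scale H k) e" "scale H k" "{e}" l u v] that by (simp add: f_def)
  have orb: "distinct_orbits (int (m * 1)) (int K) B"
    unfolding distinct_orbits_def
  proof (intro ballI allI impI)
    fix d d' l u v u' v'
    assume d: "d \<in> B" "d' \<in> B" "(l, u, v) \<in> arcs d" "(l, u', v') \<in> arcs d'"
      and code: "orbit_code (int (m * 1)) (int K) u v = orbit_code (int (m * 1)) (int K) u' v'"
    obtain e k where 1: "e \<in> F" "k \<in> {1..H}" "d = f (e, k)" using d(1) unfolding B_def by blast
    obtain e' k' where 2: "e' \<in> F" "k' \<in> {1..H}" "d' = f (e', k')" using d(2) unfolding B_def by blast
    obtain u0 v0 where 3: "(l, u0, v0) \<in> arcs e" "u = scale H k u0" "v = scale H k v0"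
      using arcB d(3) unfolding 1 by blast
    obtain u1 v1 where 4: "(l, u1, v1) \<in> arcs e'" "u' = scale H k' u1" "v' = scale H k' v1"
      using arcB d(4) unfolding 2 by blast
    have "e = e' \<and> u0 = u1 \<and> v0 = v1 \<and> k = k'"
      using eq[OF 1(1) 2(1) 1(2) 2(2) 3(1) 4(1)] code by (simp add: 3 4)
    then show "d = d' \<and> u = u' \<and> v = v'" by (simp add: 1 2 3 4)
  qed
  have "inj_on f (F \<times> {1..H})"
  proof (rule inj_onI)
    fix p p' assume p: "p \<in> F \<times> {1..H}" "p' \<in> F \<times> {1..H}" "f p = f p'"
    obtain e k where 1: "p = (e, k)" by (cases p)
    obtain e' k' where 2: "p' = (e', k')" by (cases p')
    obtain l u v where arc: "(l, u, v) \<in> arcs (f (e, k))"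
      using arcs_nonempty[of "f (e, k)"] by blast
    then have arc': "(l, u, v) \<in> arcs (f (e', k'))" using p(3) by (simp add: 1 2)
    obtain u0 v0 where 3: "(l, u0, v0) \<in> arcs e" "u = scale H k u0" "v = scale H k v0"
      using arcB[OF arc] by blast
    obtain u1 v1 where 4: "(l, u1, v1) \<in> arcs e'" "u = scale H k' u1" "v = scale H k' v1"
      using arcB[OF arc'] by blast
    have "scale H k u0 = scale H k' u1" "scale H k v0 = scale H k' v1" using 3 4 by simp_all
    then have "e = e' \<and> u0 = u1 \<and> v0 = v1 \<and> k = k'"
      using eq[OF _ _ _ _ 3(1) 4(1), of k k'] p(1,2) by (simp add: 1 2)
    then show "p = p'" by (simp add: 1 2)
  qed
  moreover have "card F = length Is + length Os"
  proof -
    have "distinct (concat (map arc_list (base_list Is Os)))" using dist by (simp add: distinct_map)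
    then have "distinct (base_list Is Os)"
      by (rule distinct_if_distinct_concat) (simp add: arc_list_def case_prod_beta)
    moreover have "length (base_list Is Os) = length Is + length Os" by (simp add: base_list_def)
    ultimately show ?thesis by (simp only: distinct_card F_def)
  qed
  ultimately have "card B = (length Is + length Os) * H"
    unfolding B_def by (simp add: card_image card_cartesian_product)
  then have "3 * card B = 3 * (length Is + length Os) * H" by simp
  then have "3 * card B = 2 * K * H" by (simp only: len)
  then have "3 * card B = (m - 1) * 1 * K" using m(1) by simp
  moreover have "proper (range Inl) (base_pts (length Os * H)) (grp (int m)) d" if d: "d \<in> B" for d
  proof -
    obtain e k where 1: "e \<in> F" "k \<in> {1..H}" "d = f (e, k)" using d unfolding B_def by blast
    obtain a b c w i j l where e: "e = (a, b, c, w, i, j, l)"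
      and r: "a \<in> range Inl" "b \<in> range Inl" "c \<in> range Inl" "w \<in> range Inl \<or> (\<exists>n<length Os. w = Inr (n, 0))"
      using shape[OF 1(1)] by blast
    \<comment> \<open>Between inner points the slope is a unit modulo \<open>m\<close> and
      \<open>0 < k < m\<close>, so scaling does not bring the two ends into one group.\<close>
    have sep: "grp (int m) (scale H k u) \<noteq> grp (int m) (scale H k v)"
      if arc: "(l', u, v) \<in> arcs e" for l' u v
    proof -
      have small: "y mod int m < int m" for y :: int by (rule pos_mod_bound) (use m(1) in simp)
      have ne: "y mod int m \<noteq> int m" "int m \<noteq> y mod int m" for y :: int using small[of y] by linarith+
      consider x z x' z' where "u = Inl (x, z)" "v = Inl (x', z')"
        | x z n r where "u = Inl (x, z)" "v = Inr (n, r)"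
        | x z n r where "u = Inr (n, r)" "v = Inl (x, z)"
        using inl[OF 1(1) arc] point_cases[of u] point_cases[of v] by blast
      then show ?thesis
      proof cases
        case c: 1
        show ?thesis
        proof
          assume "grp (int m) (scale H k u) = grp (int m) (scale H k v)"
          then have "int m dvd (x' - x) * int k" by (simp add: c mod_eq_dvd_iff algebra_simps dvd_diff_commute)
          moreover have "(x' - x) dvd 36" using slopeD[OF 1(1) arc[unfolded c]] by simp
          ultimately have "int m dvd int k" using slope_cancel m(2) by blast
          then show False using lt[OF 1(2)] zdvd_not_zless by blast
        qed
      qed (simp_all add: ne)
    qed
    have arcs: "(Some i, a, b) \<in> arcs e" "(Some j, a, c) \<in> arcs e" "(None, a, w) \<in> arcs e"
      "(Some l, b, c) \<in> arcs e" "(None, b, w) \<in> arcs e" "(None, c, w) \<in> arcs e"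
      unfolding e arcs_iff by simp_all
    have "distinct [grp (int m) (scale H k a), grp (int m) (scale H k b), grp (int m) (scale H k c), grp (int m) (scale H k w)]"
      using arcs[THEN sep] by simp
    moreover have "scale H k u \<in> range Inl" if "u \<in> range Inl" for u
      using that point_cases[of u] by auto
    moreover have "scale H k w \<in> base_pts (length Os * H)" if "n < length Os" "w = Inr (n, 0)" for n
    proof -
      have "n * H + (k - 1) < Suc n * H" using 1(2) by auto
      also have "\<dots> \<le> length Os * H" using that by (intro mult_le_mono1) simp
      finally show ?thesis by (simp add: that base_pts_def)
    qed
    ultimately show ?thesis
      using r by (auto simp: 1(3) f_def e proper_def base_pts_def)
  qed
  moreover have "finite B" by (simp add: B_def F_def)
  ultimately have "\<exists>Q. gdd (1 * K) m (3 * (length Os * H)) Q"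
    using m K by (intro gdd_translate[OF _ _ _ _ _ _ orb]) simp_all
  then show ?thesis by simp
qed

definition lin_inner_12 :: "triple_code list" where
  "lin_inner_12 = [(-1, 10, 1, 10, -2, 8, True, True, False),
   (2, 8, 1, 11, -1, 5, True, False, True),
   (1, 0, 2, 3, -2, 3, True, False, False),
   (1, 1, -2, 6, -1, 7, True, False, True)]"

definition lin_outer_12 :: "triple_code list" where
  "lin_outer_12 = [(2, 7, -2, 3, -1, 2, True, True, True),
   (1, 10, -3, 2, 0, 0, True, True, False),
   (2, 10, 0, 11, -1, 3, False, False, False),
   (2, 5, 3, 9, 0, 4, False, False, False)]"

text \<open>Entry \<open>z\<close> is the absolute slope prescribed for second difference
  \<open>z\<close>. Only 1, 2, 3 and 4 occur, all of them divisors of 36.\<close>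

definition slopes_12 :: "bool option \<Rightarrow> int \<Rightarrow> int" where
  "slopes_12 l z = (case l of
     None \<Rightarrow> [1, 1, 1, 2, 2, 1, 2, 1, 2, 2, 1, 1]
   | Some True \<Rightarrow> [2, 1, 1, 1, 4, 3, 2, 3, 4, 1, 1, 1]
   | Some False \<Rightarrow> [4, 2, 3, 3, 1, 3, 2, 3, 1, 3, 3, 2]) ! nat z"

lemma gdd_12_coprime_6:
  assumes "coprime m 6" "m > 1"
  shows "\<exists>Q. gdd 12 m (6 * (m - 1)) Q"
proof -
  have "odd m"
    using assms(1) coprime_mult_right_iff[of m 2 3] by simp
  then obtain H where H: "m = 2 * H + 1" by (elim oddE)
  \<comment> \<open>Four outer blocks with \<open>H\<close> multiples each, and three points per
    outer orbit, make \<open>12 H = 6 (m - 1)\<close> outer points.\<close>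
  have "\<exists>Q. gdd 12 m (3 * (length lin_outer_12 * H)) Q"
    by (rule gdd_linear[where Is = lin_inner_12 and tab = slopes_12, OF H assms(1)])
      (use H assms(2) in simp, simp, simp, code_simp+)
  then show ?thesis by (simp add: lin_outer_12_def H)
qed

definition lin_inner_24 :: "triple_code list" where
  "lin_inner_24 = [(2, 23, 3, 17, -1, 20, True, True, False),
   (1, 0, -2, 3, 2, 16, True, True, True),
   (-1, 22, -2, 10, 2, 10, True, False, True),
   (-2, 11, -1, 2, -3, 12, True, True, True),
   (-2, 23, 1, 5, -1, 5, False, True, False),
   (1, 6, 2, 8, -1, 15, True, False, True),
   (2, 3, 1, 18, -1, 9, True, False, False),
   (-2, 13, 1, 20, -3, 17, True, True, False)]"

definition lin_outer_24 :: "triple_code list" where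
  "lin_outer_24 = [(1, 0, 0, 2, -1, 16, True, False, False),
   (1, 12, 0, 11, 2, 16, True, True, True),
   (1, 12, 2, 1, -2, 14, False, False, True),
   (1, 17, 0, 9, 2, 4, True, False, True),
   (-1, 23, -3, 7, -2, 6, False, False, False),
   (1, 17, 3, 22, 2, 18, False, False, False),
   (3, 13, 0, 11, 2, 6, False, False, False),
   (1, 1, 0, 11, -1, 15, False, True, False)]"

definition slopes_24 :: "bool option \<Rightarrow> int \<Rightarrow> int" where
  "slopes_24 l z = (case l of
     None \<Rightarrow> [1, 2, 1, 2, 1, 1, 1, 3, 2, 1, 2, 2, 3, 2, 2, 1, 2, 3, 1, 1, 1, 2, 1, 2]
   | Some True \<Rightarrow> [4, 1, 1, 3, 1, 2, 1, 3, 1, 1, 2, 4, 1, 4, 2, 1, 1, 3, 1, 2, 1, 3, 1, 1]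
   | Some False \<Rightarrow> [2, 1, 3, 4, 1, 2, 3, 1, 2, 2, 1, 1, 3, 1, 1, 2, 2, 1, 3, 2, 1, 4, 3, 1]) ! nat z"

text \<open>This family serves \<open>t = 2m\<close>, where groups of size 12 cannot be doubled for
  want of orthogonal Latin squares of order 2.\<close>

lemma gdd_24_coprime_6:
  assumes "coprime m 6" "m > 1"
  shows "\<exists>Q. gdd 24 m (12 * (m - 1)) Q"
proof -
  have "odd m"
    using assms(1) coprime_mult_right_iff[of m 2 3] by simp
  then obtain H where H: "m = 2 * H + 1" by (elim oddE)
  have "\<exists>Q. gdd 24 m (3 * (length lin_outer_24 * H)) Q"
    by (rule gdd_linear[where Is = lin_inner_24 and tab = slopes_24, OF H assms(1)])
      (use H assms(2) in simp, simp, simp, code_simp+)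
  then show ?thesis by (simp add: lin_outer_24_def H)
qed

section \<open>Designs on 12, 24 and 36 points\<close>

text \<open>A permutation of order 3 rotates the triples \<open>{3n, 3n + 1, 3n + 2}\<close> with \<open>\<rho> n\<close> and fixes all
  other points. Fixed points have negative levels, so levels are in bijection with the orbits.\<close>

definition level :: "(int \<Rightarrow> bool) \<Rightarrow> int \<Rightarrow> int" where
  "level \<rho> p = (if \<rho> (p div 3) then p div 3 else - p - 1)"

definition rotate :: "(int \<Rightarrow> bool) \<Rightarrow> int \<Rightarrow> int \<Rightarrow> int" where
  "rotate \<rho> i p = (if \<rho> (p div 3) then 3 * (p div 3) + (p + i) mod 3 else p)"

text \<open>Orbits of unordered pairs: the pairs inside one rotated triple form a single orbit; so
  do those of a fixed point with a rotated triple; those between two rotated triples form three,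
  told apart by the difference modulo 3 taken from the lower level to the higher one.\<close>

definition edge_code :: "(int \<Rightarrow> bool) \<Rightarrow> int \<Rightarrow> int \<Rightarrow> int \<times> int \<times> int" where
  "edge_code \<rho> u v = (let a = level \<rho> u; b = level \<rho> v in
     if a = b then (a, a, 1)
     else if a < 0 \<or> b < 0 then (min a b, max a b, 0)
     else if a < b then (a, b, (v - u) mod 3) else (b, a, (u - v) mod 3))"

lemma level_rotate: "level \<rho> (rotate \<rho> i p) = level \<rho> p"
  by (auto simp: level_def rotate_def)

lemma edge_code_rotate:
  assumes "\<And>n. \<rho> n \<Longrightarrow> n \<ge> 0" "u \<ge> 0" "v \<ge> 0"
  shows "edge_code \<rho> (rotate \<rho> i u) (rotate \<rho> i v) = edge_code \<rho> u v"
proof -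
  have *: "(rotate \<rho> i x - rotate \<rho> i y) mod 3 = (x - y) mod 3" if "level \<rho> x \<ge> 0" "level \<rho> y \<ge> 0" "x \<ge> 0" "y \<ge> 0" for x y
  proof -
    have "\<rho> (x div 3)" "\<rho> (y div 3)" using that by (auto simp: level_def split: if_splits)
    then have "(rotate \<rho> i x - rotate \<rho> i y) mod 3 = (3 * (x div 3 - y div 3) + ((x + i) mod 3 - (y + i) mod 3)) mod 3"
      by (simp add: rotate_def algebra_simps)
    also have "\<dots> = ((x + i) mod 3 - (y + i) mod 3) mod 3" by (rule mod_mult_self4)
    also have "\<dots> = (x - y) mod 3" by (simp add: mod_diff_eq)
    finally show ?thesis .
  qed
  show ?thesis
    unfolding edge_code_def level_rotate Let_def using * assms by (auto simp: not_less)
qed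

lemma edge_code_sym: "edge_code \<rho> u v = edge_code \<rho> v u"
  unfolding edge_code_def Let_def by (auto simp: min.commute max.commute)

text \<open>A rotated end determines the rotation if the edge keeps its orientation. Reversal would
  mean that 3 divides \<open>2 (u - v)\<close> with both ends in one triple, so that
  \<open>u = v\<close>: a permutation of order 3 reverses no edge.\<close>

lemma rotate_arc_inj:
  assumes rho: "\<And>n. \<rho> n \<Longrightarrow> n \<ge> 0" and uv: "u \<ge> 0" "v \<ge> 0" "u \<noteq> v" and r: "\<rho> (u div 3) \<or> \<rho> (v div 3)"
    and ij: "i \<in> {0..<3}" "j \<in> {0..<3}"
    and same: "u' = u \<and> v' = v \<or> u' = v \<and> v' = u"
    and eq: "rotate \<rho> i u = rotate \<rho> j u'" "rotate \<rho> i v = rotate \<rho> j v'"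
  shows "i = j"
proof -
  have cancel: "i = j" if "rotate \<rho> i p = rotate \<rho> j p" "\<rho> (p div 3)" for p
  proof -
    have "(p + i) mod 3 = (p + j) mod 3" using that by (simp add: rotate_def)
    then have "i mod 3 = j mod 3" by (simp add: mod_eq_dvd_iff)
    then show ?thesis using ij by simp
  qed
  show ?thesis
  proof (cases "u' = u \<and> v' = v")
    case True
    then show ?thesis using cancel r eq by blast
  next
    case False
    then have e: "rotate \<rho> i u = rotate \<rho> j v" "rotate \<rho> i v = rotate \<rho> j u" using same eq by auto
    then have l: "level \<rho> u = level \<rho> v" by (metis level_rotate)
    then have ru: "\<rho> (u div 3)" "\<rho> (v div 3)" "u div 3 = v div 3"
      using r rho uv by (auto simp: level_def split: if_splits)
    then have "(u + i) mod 3 = (v + j) mod 3" "(v + i) mod 3 = (u + j) mod 3"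
      using e by (simp_all add: rotate_def)
    then have "3 dvd u + i - (v + j)" "3 dvd v + i - (u + j)" by (simp_all only: mod_eq_dvd_iff)
    then have "3 dvd u + i - (v + j) - (v + i - (u + j))" by (rule dvd_diff)
    then have "3 dvd 2 * (u - v)" by (simp add: algebra_simps)
    then have "3 dvd u - v" by presburger
    then have "u mod 3 = v mod 3" by (simp only: mod_eq_dvd_iff)
    then have "u = v" using ru(3) by (metis div_mult_mod_eq)
    then show ?thesis using uv(3) by simp
  qed
qed

text \<open>One orientation is enough, since \<open>edge_code\<close> is symmetric. Filtering by
  label allows a separate, shorter check for each label.\<close>

definition edges_of :: "bool option \<Rightarrow> int quad \<Rightarrow> (bool option \<times> int \<times> int) list" where
  "edges_of l = (\<lambda>(a, b, c, w, i, j, k).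
     filter (\<lambda>x. fst x = l) [(None, a, w), (None, b, w), (None, c, w), (Some i, a, b), (Some j, a, c), (Some k, b, c)])"

lemma arcs_edges_of:
  assumes "(l, u, v) \<in> arcs e"
  shows "(l, u, v) \<in> set (edges_of l e) \<or> (l, v, u) \<in> set (edges_of l e)"
proof -
  obtain a b c w i j k where e: "e = (a, b, c, w, i, j, k)" by (cases e)
  show ?thesis using assms unfolding e arcs_iff edges_of_def prod.case set_filter list.set
    by (elim disjE) simp_all
qed

fun quad_in :: "int \<Rightarrow> int \<Rightarrow> int quad \<Rightarrow> bool" where
  "quad_in v y (a, b, c, w, _) \<longleftrightarrow>
     distinct [a, b, c, w] \<and> list_all (\<lambda>x. 0 \<le> x \<and> x < v) [a, b, c] \<and> 0 \<le> w \<and> w < y"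

text \<open>A whole triple nested at a fixed point is invariant under rotation. Its sides form one
  orbit and hence carry one label; its star is one orbit as well, so \<open>level_quad_edges\<close>
  keeps one representative of each.\<close>

fun level_quad :: "int \<times> int \<times> bool \<Rightarrow> int quad" where
  "level_quad (x, w, l) = (3 * x, 3 * x + 1, 3 * x + 2, w, l, l, l)"

fun level_quad_edges :: "bool option \<Rightarrow> int \<times> int \<times> bool \<Rightarrow> (bool option \<times> int \<times> int) list" where
  "level_quad_edges m (x, w, l) = filter (\<lambda>x. fst x = m) [(None, 3 * x, w), (Some l, 3 * x, 3 * x + 1)]"

definition edge_codes ::
    "(int \<Rightarrow> bool) \<Rightarrow> int quad list \<Rightarrow> (int \<times> int \<times> bool) list \<Rightarrow> bool option \<Rightarrow> (int \<times> int \<times> int) list" where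
  "edge_codes \<rho> Bs Fs l = map (\<lambda>(l, u, v). edge_code \<rho> u v)
     (concat (map (edges_of l) Bs) @ concat (map (level_quad_edges l) Fs))"

text \<open>\<open>Bs\<close> yields orbits of three quads, and \<open>Fs\<close> lists the
  invariant quads. These are unavoidable when the number of quads is not a multiple of 3: there are
  44, 184 and 420 quads for 12, 24 and 36 points.\<close>

lemma gdd_1_rotations:
  fixes L M :: nat
  assumes rho: "\<And>n. \<rho> n \<Longrightarrow> n \<ge> 0" "\<And>n. 0 \<le> n \<Longrightarrow> n < int L \<Longrightarrow> \<rho> n"
    and Bs: "list_all (quad_in (3 * int L) (3 * int M)) Bs"
    and Fs: "list_all (\<lambda>(x, w, l). 0 \<le> x \<and> x < int L \<and> 3 * int L \<le> w \<and> w < 3 * int M \<and> \<not> \<rho> (w div 3)) Fs"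
    and split: "list_all (distinct_split ts) (map (edge_codes \<rho> Bs Fs) [None, Some True, Some False])"
    and len: "3 * (3 * length Bs + length Fs) = 3 * L * (3 * L - 1)" and "L \<le> M"
  shows "\<exists>Q. gdd 1 (3 * L) (3 * (M - L)) Q"
proof -
  \<comment> \<open>\<open>?h\<close> keeps the points of \<open>X\<close> apart and merges all
    outer points into one group.\<close>
  let ?X = "{0..<3 * int L}" and ?Y = "{0..<3 * int M}" and ?h = "\<lambda>x. min x (3 * int L)"
  let ?code = "\<lambda>(l, u, v). edge_code \<rho> u v"
  define f where "f = (\<lambda>(e, i). map_quad (rotate \<rho> i) e)"
  define R where "R = f ` (set Bs \<times> {0..<3})"
  define T where "T = level_quad ` set Fs"
  have all: "distinct_split ts (map ?code (concat (map (edges_of l) Bs) @ concat (map (level_quad_edges l) Fs)))" for l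
    using split unfolding edge_codes_def by (cases l; cases "the l") simp_all
  have dist: "distinct (map ?code (concat (map (edges_of l) Bs)))" "distinct (map ?code (concat (map (level_quad_edges l) Fs)))"
    "?code ` set (concat (map (edges_of l) Bs)) \<inter> ?code ` set (concat (map (level_quad_edges l) Fs)) = {}" for l
    using distinct_split_imp_distinct[OF all[of l]] unfolding map_append distinct_append set_map by blast+
  have qB: "quad_in (3 * int L) (3 * int M) e" if "e \<in> set Bs" for e using Bs that by (simp add: list_all_iff)
  have pB: "proper ?X ?Y id e" if "e \<in> set Bs" for e
    using qB[OF that] by (cases e) (simp add: proper_def)
  have rot: "3 * (p div 3) \<le> rotate \<rho> i p \<and> rotate \<rho> i p < 3 * (p div 3) + 3" for i p
    unfolding rotate_def by auto
  have rotX: "rotate \<rho> i p \<in> {3 * x..<3 * y}" if "p \<in> {3 * x..<3 * y}" for i p x y :: int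
  proof -
    have "x \<le> p div 3" "p div 3 < y" using that unfolding atLeastLessThan_iff by presburger+
    then show ?thesis using rot[of p i] unfolding atLeastLessThan_iff by linarith
  qed
  have arcB: "u \<in> ?Y \<and> v \<in> ?Y \<and> u \<noteq> v \<and> (u \<in> ?X \<or> v \<in> ?X)" if "e \<in> set Bs" "(l, u, v) \<in> arcs e" for e l u v
  proof -
    obtain a b c w i j k where e: "e = (a, b, c, w, i, j, k)" by (cases e)
    have "a \<in> ?X" "b \<in> ?X" "c \<in> ?X" using proper_mem[OF pB[OF that(1), unfolded e]] by simp_all
    moreover have "u \<in> ?Y" "v \<in> ?Y" using arcs_subset[OF pB[OF that(1)] _ that(2)] \<open>L \<le> M\<close> by auto
    moreover have "u \<noteq> v" using arcs_separated[OF pB[OF that(1)] that(2)] by simp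
    ultimately show ?thesis using that(2) unfolding e arcs_iff by (elim disjE) simp_all
  qed
  have rX: "\<rho> (p div 3)" if "p \<in> ?X" for p
    using that unfolding atLeastLessThan_iff by (intro rho(2)) presburger+
  have arcR: "\<exists>u0 v0. (l, u0, v0) \<in> arcs e \<and> u = rotate \<rho> i u0 \<and> v = rotate \<rho> i v0"
    if "(l, u, v) \<in> arcs (f (e, i))" for e i l u v
    using arcs_image_map_quad[of "map_quad (rotate \<rho> i) e" "rotate \<rho> i" "{e}" l u v] that by (simp add: f_def)
  have codeB: "edge_code \<rho> u v \<in> ?code ` set (concat (map (edges_of l) Bs))"
    if e: "e \<in> set Bs" "(l, u0, v0) \<in> arcs e" and uv: "u = rotate \<rho> i u0" "v = rotate \<rho> i v0" for e i l u v u0 v0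
  proof -
    have "edge_code \<rho> u v = edge_code \<rho> u0 v0"
      using edge_code_rotate[of \<rho> u0 v0 i, OF rho(1)] arcB[OF e] unfolding uv by simp
    moreover have "\<exists>x\<in>set (edges_of l e). ?code x = edge_code \<rho> u0 v0"
      using arcs_edges_of[OF e(2)]
    proof
      assume "(l, u0, v0) \<in> set (edges_of l e)"
      then show ?thesis by (rule rev_bexI) simp
    next
      assume "(l, v0, u0) \<in> set (edges_of l e)"
      then show ?thesis by (rule rev_bexI) (simp add: edge_code_sym[of \<rho> v0 u0])
    qed
    ultimately obtain x where "x \<in> set (edges_of l e)" "edge_code \<rho> u v = ?code x" by metis
    then show ?thesis using e(1) unfolding set_concat set_map by (intro image_eqI[of _ _ x]) blast+
  qed
  have eqB: "e = e' \<and> i = j"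
    if e: "e \<in> set Bs" "e' \<in> set Bs" and ij: "i \<in> {0..<3}" "j \<in> {0..<3}"
      and arc: "(l, u, v) \<in> arcs (f (e, i))" "(l, u, v) \<in> arcs (f (e', j))" for e e' i j l u v
  proof -
    obtain u0 v0 where 0: "(l, u0, v0) \<in> arcs e" "u = rotate \<rho> i u0" "v = rotate \<rho> i v0"
      using arcR[OF arc(1)] by blast
    obtain u1 v1 where 1: "(l, u1, v1) \<in> arcs e'" "u = rotate \<rho> j u1" "v = rotate \<rho> j v1"
      using arcR[OF arc(2)] by blast
    have "edge_code \<rho> u v = edge_code \<rho> u0 v0" "edge_code \<rho> u v = edge_code \<rho> u1 v1"
      using edge_code_rotate[of \<rho> u0 v0 i, OF rho(1)] edge_code_rotate[of \<rho> u1 v1 j, OF rho(1)]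
        arcB[OF e(1) 0(1)] arcB[OF e(2) 1(1)] unfolding 0(2,3)[symmetric] 1(2,3)[symmetric]
      by simp_all
    then have c: "edge_code \<rho> u0 v0 = edge_code \<rho> u1 v1" by simp
    obtain x where x: "x \<in> set (edges_of l e)" "x = (l, u0, v0) \<or> x = (l, v0, u0)"
      using arcs_edges_of[OF 0(1)] by blast
    obtain y where y: "y \<in> set (edges_of l e')" "y = (l, u1, v1) \<or> y = (l, v1, u1)"
      using arcs_edges_of[OF 1(1)] by blast
    have "?code x = ?code y" using x(2) y(2) c edge_code_sym[of \<rho> u0 v0] edge_code_sym[of \<rho> u1 v1] by auto
    then have xy: "e = e' \<and> x = y"
      by (rule distinct_map_concat_inj[OF dist(1) e x(1) y(1)])
    then have "u1 = u0 \<and> v1 = v0 \<or> u1 = v0 \<and> v1 = u0" using x(2) y(2) by auto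
    moreover have "\<rho> (u0 div 3) \<or> \<rho> (v0 div 3)" "u0 \<ge> 0" "v0 \<ge> 0" "u0 \<noteq> v0"
      using arcB[OF e(1) 0(1)] rX by auto
    ultimately have "i = j"
      using rotate_arc_inj[OF rho(1) _ _ _ _ ij] 0 1 by metis
    then show ?thesis using xy by simp
  qed
  have FD: "0 \<le> x \<and> x < int L \<and> 3 * int L \<le> w \<and> w < 3 * int M \<and> \<not> \<rho> (w div 3)" if "(x, w, l) \<in> set Fs" for x w l
    using Fs that by (auto simp: list_all_iff)
  have arcT: "\<exists>y\<in>set (level_quad_edges m t). ?code y = edge_code \<rho> u v"
    if t: "t \<in> set Fs" "(m, u, v) \<in> arcs (level_quad t)" for t m u v
  proof -
    obtain x w l where e: "t = (x, w, l)" by (cases t)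
    note F = FD[OF t(1)[unfolded e]]
    have d: "(3 * x) div 3 = x" "(3 * x + 1) div 3 = x" "(3 * x + 2) div 3 = x" by presburger+
    have lv: "level \<rho> (3 * x) = x" "level \<rho> (3 * x + 1) = x" "level \<rho> (3 * x + 2) = x"
      using F rho(2)[of x] by (simp_all add: level_def d)
    have lw: "level \<rho> w = - w - 1" "- w - 1 < x" "- w - 1 < 0" using F by (simp_all add: level_def)
    have "edge_code \<rho> (3 * x) w = (- w - 1, x, 0)" "edge_code \<rho> (3 * x + 1) w = (- w - 1, x, 0)"
      "edge_code \<rho> (3 * x + 2) w = (- w - 1, x, 0)"
      using lw F by (simp_all add: edge_code_def lv lw(1) Let_def min_def max_def)
    moreover have "edge_code \<rho> a b = (x, x, 1)" if "a \<in> {3 * x, 3 * x + 1, 3 * x + 2}" "b \<in> {3 * x, 3 * x + 1, 3 * x + 2}" for a b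
      using that by (auto simp: edge_code_def lv Let_def)
    ultimately show ?thesis using t(2) edge_code_sym[of \<rho> w] unfolding e level_quad.simps arcs_iff
      by (elim disjE) simp_all
  qed
  have eqT: "t = t'" if t: "t \<in> set Fs" "t' \<in> set Fs" "(l, u, v) \<in> arcs (level_quad t)" "(l, u, v) \<in> arcs (level_quad t')" for t t' l u v
  proof -
    obtain y y' where "y \<in> set (level_quad_edges l t)" "?code y = edge_code \<rho> u v"
      "y' \<in> set (level_quad_edges l t')" "?code y' = edge_code \<rho> u v"
      using arcT[OF t(1,3)] arcT[OF t(2,4)] by blast
    then show ?thesis using distinct_map_concat_inj[OF dist(2) t(1,2), of y l y'] by simp
  qed
  have RT: False if d: "d \<in> R" and d': "d' \<in> T" and arc: "(l, u, v) \<in> arcs d" "(l, u, v) \<in> arcs d'" for d d' l u v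
  proof -
    obtain e i where e: "e \<in> set Bs" "d = f (e, i)" using d unfolding R_def by blast
    obtain t where t: "t \<in> set Fs" "d' = level_quad t" using d' unfolding T_def by blast
    obtain u0 v0 where 0: "(l, u0, v0) \<in> arcs e" "u = rotate \<rho> i u0" "v = rotate \<rho> i v0"
      using arcR arc(1) unfolding e(2) by blast
    have "edge_code \<rho> u v \<in> ?code ` set (concat (map (edges_of l) Bs))" by (rule codeB[OF e(1) 0])
    moreover have "edge_code \<rho> u v \<in> ?code ` set (concat (map (level_quad_edges l) Fs))"
    proof -
      obtain y where "y \<in> set (level_quad_edges l t)" "edge_code \<rho> u v = ?code y"
        using arcT[OF t(1) arc(2)[unfolded t(2)]] by metis
      then show ?thesis using t(1) unfolding set_concat set_map by (intro image_eqI[of _ _ y]) blast+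
    qed
    ultimately show False using dist(3)[of l] by blast
  qed
  have PR: "packing ?X ?Y ?h R"
  proof (rule packingI)
    fix d assume "d \<in> R"
    then obtain e i where e: "e \<in> set Bs" "d = f (e, i)" unfolding R_def by blast
    have inj: "rotate \<rho> i x \<noteq> rotate \<rho> i y" if "x \<noteq> y" for x y
    proof
      assume *: "rotate \<rho> i x = rotate \<rho> i y"
      then have "x div 3 = y div 3" using rot[of x i] rot[of y i] by presburger
      moreover from this * have "x mod 3 = y mod 3 \<or> x = y"
        by (auto simp: rotate_def mod_eq_dvd_iff split: if_splits)
      ultimately show False using that by (metis div_mult_mod_eq)
    qed
    obtain a b c w i' j k where q: "e = (a, b, c, w, i', j, k)" by (cases e)
    have "distinct [a, b, c, w]" "a \<in> ?X" "b \<in> ?X" "c \<in> ?X" "w \<in> ?Y" using qB[OF e(1)] by (simp_all add: q)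
    then have "distinct [rotate \<rho> i a, rotate \<rho> i b, rotate \<rho> i c, rotate \<rho> i w]"
      "rotate \<rho> i a \<in> ?X" "rotate \<rho> i b \<in> ?X" "rotate \<rho> i c \<in> ?X" "rotate \<rho> i w \<in> ?Y"
      using inj rotX[of _ 0 "int L"] rotX[of _ 0 "int M"] by simp_all
    then show "proper ?X ?Y ?h d" by (auto simp: e(2) f_def q proper_def min_def)
  next
    fix d d' l u v assume d: "d \<in> R" "d' \<in> R" "(l, u, v) \<in> arcs d" "(l, u, v) \<in> arcs d'"
    obtain e i e' i' where *: "e \<in> set Bs" "e' \<in> set Bs" "i \<in> {0..<3}" "i' \<in> {0..<3}" "d = f (e, i)" "d' = f (e', i')"
      using d(1,2) unfolding R_def by blast
    show "d = d'" using eqB[OF *(1-4) d(3,4)[unfolded *(5,6)]] by (simp add: *)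
  qed
  have PT: "packing ?X ?Y ?h T"
  proof (rule packingI)
    fix d assume "d \<in> T"
    then obtain x w l where t: "(x, w, l) \<in> set Fs" "d = level_quad (x, w, l)"
      unfolding T_def by (metis imageE surj_pair)
    then show "proper ?X ?Y ?h d" using FD[OF t(1)] by (auto simp: proper_def)
  next
    fix d d' l u v assume d: "d \<in> T" "d' \<in> T" "(l, u, v) \<in> arcs d" "(l, u, v) \<in> arcs d'"
    then obtain t t' where t: "t \<in> set Fs" "t' \<in> set Fs" "d = level_quad t" "d' = level_quad t'" unfolding T_def by blast
    show "d = d'" using eqT[OF t(1,2)] d(3,4) unfolding t(3,4) by blast
  qed
  have P: "packing ?X ?Y ?h (R \<union> T)"
    by (rule packing_Un[OF PR PT]) (use RT in \<open>fast\<close>)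
  have "distinct Bs"
  proof -
    have "distinct (map ?code (concat (map (edges_of None) Bs)))" by (rule dist(1))
    then have "distinct (concat (map (edges_of None) Bs))" by (simp add: distinct_map)
    then show ?thesis by (rule distinct_if_distinct_concat) (simp add: edges_of_def case_prod_beta)
  qed
  moreover have "distinct Fs"
  proof -
    have "distinct (map ?code (concat (map (level_quad_edges None) Fs)))" by (rule dist(2))
    then have "distinct (concat (map (level_quad_edges None) Fs))" by (simp add: distinct_map)
    moreover have "level_quad_edges None t \<noteq> []" for t by (cases t) simp
    ultimately show ?thesis by (rule distinct_if_distinct_concat)
  qed
  moreover have "inj_on f (set Bs \<times> {0..<3})"
  proof (rule inj_onI)
    fix p p' assume p: "p \<in> set Bs \<times> {0..<3}" "p' \<in> set Bs \<times> {0..<3}" "f p = f p'"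
    obtain e i where 1: "p = (e, i)" by (cases p)
    obtain e' i' where 2: "p' = (e', i')" by (cases p')
    obtain l u v where "(l, u, v) \<in> arcs (f (e, i))" using arcs_nonempty[of "f (e, i)"] by blast
    then show "p = p'" using eqB[of e e' i i' l u v] p by (simp add: 1 2)
  qed
  moreover have "inj_on level_quad (set Fs)" by (rule inj_onI) auto
  moreover have "e \<notin> T" if "e \<in> R" for e
    using RT[OF that, of e] arcs_nonempty[of e] by blast
  then have "R \<inter> T = {}" by blast
  ultimately have "card (R \<union> T) = 3 * length Bs + length Fs"
    by (simp add: R_def T_def card_Un_disjoint card_image card_cartesian_product distinct_card mult.commute)
  then have cQ: "3 * card (R \<union> T) = 3 * L * (3 * L - 1)" using len by simp
  define \<phi> :: "int \<Rightarrow> nat \<times> nat" where "\<phi> x = (if x < 3 * int L then (nat x, 0) else (3 * L, nat x - 3 * L))" for x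
  have inj: "inj_on \<phi> ?Y"
    by (rule inj_onI) (auto simp: \<phi>_def split: if_splits)
  have "packing ({..<3 * L} \<times> {..<1}) ({..<3 * L} \<times> {..<1} \<union> {3 * L} \<times> {..<3 * (M - L)}) fst (map_quad \<phi> ` (R \<union> T))"
    using \<open>L \<le> M\<close> by (intro packing_map[OF P _ inj]) (auto simp: \<phi>_def min_def split: if_splits)
  moreover have "card (map_quad \<phi> ` (R \<union> T)) = card (R \<union> T)"
    using \<open>L \<le> M\<close> by (intro card_map_quad[OF P _ inj]) auto
  ultimately have "gdd 1 (3 * L) (3 * (M - L)) (map_quad \<phi> ` (R \<union> T))" using cQ by (simp add: gdd_def)
  then show ?thesis by blast
qed

text \<open>Any tests are sound. The negative thresholds split the levels -37 to -54 of the fixed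
  outer points for \<open>v = 36\<close>, the others split the levels of the rotated
  triples.\<close>

definition edge_tests :: "(int \<times> int \<times> int \<Rightarrow> bool) list" where
  "edge_tests = map (\<lambda>n (a, b, d). a < n) [-50, -46, -42, 0, 2, 4, 6, 8] @
     map (\<lambda>n (a, b, d). b < n) [4, 8] @ [\<lambda>(a, b, d). d = 1]"

definition base_12 :: "int quad list" where
  "base_12 = [(0, 1, 10, 6, False, True, True),
   (0, 3, 4, 9, True, True, True),
   (0, 3, 6, 16, False, True, True),
   (0, 4, 5, 14, False, True, False),
   (0, 5, 9, 1, False, False, True),
   (0, 6, 8, 3, False, True, True),
   (0, 7, 8, 13, True, False, False),
   (0, 7, 11, 15, False, True, True),
   (0, 10, 11, 12, False, False, False),
   (3, 6, 9, 7, False, True, True),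
   (3, 7, 9, 10, True, False, True),
   (3, 7, 11, 14, False, True, False),
   (3, 8, 10, 17, True, False, False),
   (3, 8, 11, 1, False, False, False)]"

definition fixed_12 :: "(int \<times> int \<times> bool) list" where
  "fixed_12 = [(0, 17, True),
   (3, 16, True)]"

lemma gdd_1_12: "\<exists>Q. gdd 1 12 6 Q"
proof -
  have "\<exists>Q. gdd 1 (3 * 4) (3 * (6 - 4)) Q"
  \<comment> \<open>The outer points 12, 13, 14 are rotated, and 15, 16, 17 are fixed.\<close>
  proof (rule gdd_1_rotations[where \<rho> = "\<lambda>n. 0 \<le> n \<and> n < 5" and Bs = base_12 and Fs = fixed_12 and ts = edge_tests])
    show "3 * (3 * length base_12 + length (fixed_12 :: (int \<times> int \<times> bool) list)) = 3 * 4 * (3 * 4 - 1)"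
      by (simp add: base_12_def fixed_12_def)
  qed (force, force, code_simp, code_simp, code_simp, simp)
  then show ?thesis by simp
qed

definition base_24 :: "int quad list" where
  "base_24 = [(2, 5, 16, 11, True, True, True),
   (3, 19, 21, 15, True, True, True),
   (17, 22, 9, 8, True, True, True),
   (13, 1, 21, 23, True, True, True),
   (15, 12, 4, 9, True, False, True),
   (0, 21, 9, 20, True, True, True),
   (2, 12, 16, 15, True, False, True),
   (5, 22, 1, 19, True, True, False),
   (6, 21, 20, 8, True, True, True),
   (16, 18, 6, 5, True, True, True),
   (14, 9, 16, 1, True, True, True),
   (6, 13, 19, 17, True, True, True),
   (23, 3, 13, 12, False, True, True),
   (15, 13, 7, 22, False, True, True),
   (4, 19, 16, 14, True, True, True),
   (11, 14, 5, 20, True, True, True),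
   (21, 2, 8, 3, True, True, True),
   (1, 7, 11, 4, False, True, True),
   (0, 14, 19, 6, True, True, True),
   (6, 2, 3, 16, True, True, False),
   (7, 5, 9, 13, True, True, True),
   (21, 7, 17, 10, True, True, False),
   (4, 16, 1, 21, False, False, True),
   (23, 7, 14, 2, False, True, False),
   (2, 20, 11, 13, True, False, True),
   (1, 18, 17, 20, True, True, True),
   (6, 4, 9, 2, False, True, True),
   (12, 19, 10, 8, True, False, False),
   (22, 11, 19, 9, True, True, True),
   (10, 3, 20, 22, False, True, True),
   (13, 8, 17, 24, True, False, True),
   (4, 9, 20, 24, False, False, False),
   (0, 11, 8, 25, True, True, False),
   (14, 20, 21, 25, False, False, False),
   (9, 1, 21, 26, False, False, False),
   (16, 7, 20, 26, False, False, False),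
   (2, 13, 7, 27, False, False, False),
   (21, 3, 16, 27, False, False, True),
   (5, 12, 11, 28, False, False, True),
   (21, 17, 2, 28, False, False, False),
   (16, 19, 22, 29, False, True, False),
   (1, 14, 3, 29, False, True, False),
   (18, 3, 6, 30, False, False, False),
   (16, 13, 9, 30, False, False, False),
   (6, 23, 10, 31, False, False, False),
   (18, 4, 2, 31, False, False, False),
   (20, 22, 13, 32, False, False, False),
   (7, 9, 15, 32, False, False, True),
   (11, 16, 18, 33, False, False, False),
   (2, 9, 15, 33, False, False, False),
   (19, 1, 8, 33, False, False, False),
   (22, 7, 3, 33, False, True, True),
   (6, 14, 5, 33, False, False, False),
   (21, 13, 10, 33, False, False, False),
   (23, 17, 4, 33, False, False, False),
   (12, 0, 20, 33, False, False, False)]"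

definition fixed_24 :: "(int \<times> int \<times> bool) list" where
  "fixed_24 = [(0, 24, True),
   (7, 24, True),
   (5, 25, True),
   (1, 25, True),
   (4, 26, True),
   (1, 26, False),
   (6, 27, True),
   (3, 27, True),
   (6, 28, False),
   (2, 28, True),
   (2, 29, False),
   (3, 29, False),
   (0, 30, False),
   (7, 30, False),
   (4, 31, False),
   (5, 31, False)]"

lemma gdd_1_24: "\<exists>Q. gdd 1 24 12 Q"
proof -
  have "\<exists>Q. gdd 1 (3 * 8) (3 * (12 - 8)) Q"
  \<comment> \<open>The outer points 24 to 32 are fixed, and 33, 34, 35 are rotated.\<close>
  proof (rule gdd_1_rotations[where \<rho> = "\<lambda>n. 0 \<le> n \<and> n < 8 \<or> n = 11" and Bs = base_24 and Fs = fixed_24 and ts = edge_tests])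
    show "3 * (3 * length base_24 + length (fixed_24 :: (int \<times> int \<times> bool) list)) = 3 * 8 * (3 * 8 - 1)"
      by (simp add: base_24_def fixed_24_def)
  qed (force, force, code_simp, code_simp, code_simp, simp)
  then show ?thesis by simp
qed

definition base_36 :: "int quad list" where
  "base_36 = [(15, 0, 29, 20, True, True, True),
   (25, 34, 30, 21, True, True, True),
   (29, 13, 28, 18, True, True, True),
   (26, 24, 9, 21, True, True, True),
   (24, 20, 28, 5, True, True, True),
   (15, 17, 1, 6, True, True, True),
   (1, 34, 13, 0, True, True, True),
   (7, 33, 25, 1, True, True, True),
   (30, 23, 11, 13, True, True, True),
   (33, 14, 18, 17, True, True, True),
   (33, 2, 34, 25, True, True, True),
   (18, 16, 15, 2, True, True, False),
   (34, 20, 29, 32, True, True, True),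
   (31, 8, 17, 13, True, True, True),
   (20, 23, 9, 30, True, True, True),
   (3, 4, 25, 14, True, True, True),
   (6, 22, 17, 23, True, True, True),
   (4, 24, 14, 11, True, True, True),
   (9, 31, 10, 15, False, True, True),
   (9, 4, 17, 32, True, True, True),
   (3, 15, 25, 24, True, False, True),
   (28, 34, 27, 35, True, False, True),
   (25, 15, 26, 13, False, False, True),
   (11, 0, 2, 28, True, True, True),
   (23, 34, 13, 4, True, True, False),
   (2, 19, 20, 23, True, True, True),
   (18, 19, 24, 10, False, True, True),
   (26, 29, 22, 15, True, True, True),
   (13, 8, 10, 32, True, True, True),
   (32, 22, 16, 30, False, True, True),
   (30, 35, 33, 7, True, True, False),
   (21, 9, 22, 13, False, True, True),
   (7, 5, 6, 25, True, True, True),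
   (4, 35, 19, 21, True, True, True),
   (2, 27, 10, 17, True, False, True),
   (8, 7, 26, 20, False, False, True),
   (19, 0, 3, 30, True, True, True),
   (12, 11, 20, 18, True, True, True),
   (4, 1, 30, 8, False, True, True),
   (31, 11, 5, 34, True, False, True),
   (23, 7, 15, 27, False, False, False),
   (5, 21, 25, 29, True, False, False),
   (35, 26, 12, 19, False, True, True),
   (30, 8, 13, 29, True, True, False),
   (20, 31, 32, 25, True, True, True),
   (3, 9, 10, 4, False, True, False),
   (1, 7, 29, 23, True, False, True),
   (31, 18, 23, 5, True, True, True),
   (3, 12, 23, 8, True, True, True),
   (22, 23, 0, 9, False, True, True),
   (29, 32, 8, 27, True, True, True),
   (28, 10, 15, 25, True, True, False),
   (6, 26, 18, 33, True, True, False),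
   (33, 27, 11, 0, False, True, True),
   (7, 14, 19, 8, True, False, False),
   (27, 19, 8, 5, False, False, True),
   (1, 6, 31, 26, True, True, False),
   (9, 35, 28, 10, True, False, False),
   (12, 13, 25, 27, True, False, True),
   (3, 28, 30, 34, True, True, True),
   (14, 1, 0, 12, True, True, False),
   (5, 4, 21, 16, False, False, False),
   (16, 1, 33, 19, False, True, False),
   (15, 12, 21, 33, True, False, True),
   (28, 2, 33, 9, False, False, False),
   (6, 3, 15, 16, True, False, False),
   (15, 13, 12, 35, True, False, False),
   (30, 32, 21, 1, False, True, False),
   (10, 21, 28, 36, False, False, False),
   (26, 14, 30, 36, False, True, True),
   (20, 2, 3, 36, False, True, True),
   (35, 15, 8, 36, False, True, True),
   (22, 12, 35, 37, False, True, False),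
   (7, 10, 20, 37, True, True, True),
   (26, 27, 15, 37, False, False, True),
   (3, 31, 1, 37, True, True, False),
   (30, 29, 24, 38, True, True, True),
   (8, 1, 22, 38, True, True, True),
   (33, 10, 3, 38, False, True, False),
   (14, 15, 18, 38, True, False, False),
   (10, 17, 7, 39, True, False, False),
   (4, 25, 18, 39, False, False, False),
   (2, 30, 35, 39, True, False, False),
   (27, 22, 13, 39, True, True, False),
   (22, 15, 34, 40, True, True, True),
   (20, 29, 30, 40, False, False, False),
   (8, 10, 24, 40, False, False, False),
   (12, 4, 0, 40, True, False, False),
   (22, 20, 27, 41, False, False, True),
   (30, 12, 2, 41, True, False, False),
   (8, 33, 4, 41, True, False, True),
   (15, 24, 11, 41, True, False, True),
   (16, 5, 20, 42, True, True, False),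
   (10, 31, 34, 42, False, True, False),
   (29, 2, 6, 42, True, True, False),
   (21, 13, 24, 42, False, True, False),
   (23, 35, 25, 43, False, True, True),
   (4, 2, 9, 43, False, False, True),
   (32, 12, 8, 43, False, False, False),
   (17, 19, 29, 43, False, False, False),
   (22, 24, 0, 44, False, False, True),
   (29, 3, 16, 44, True, False, False),
   (20, 6, 32, 44, False, False, False),
   (10, 13, 35, 44, False, False, False),
   (20, 11, 21, 45, False, True, False),
   (13, 15, 29, 45, False, False, False),
   (31, 2, 25, 45, False, False, True),
   (6, 4, 35, 45, False, False, False),
   (26, 28, 30, 46, False, False, False),
   (8, 23, 2, 46, True, False, False),
   (13, 11, 19, 46, True, True, False),
   (15, 33, 4, 46, True, False, False),
   (14, 30, 15, 47, False, False, True),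
   (8, 28, 22, 47, False, False, True),
   (26, 1, 11, 47, True, False, False),
   (4, 20, 34, 47, False, False, False),
   (22, 33, 25, 48, False, False, False),
   (30, 3, 12, 48, False, False, False),
   (20, 0, 16, 48, False, False, False),
   (27, 6, 10, 48, False, False, True),
   (9, 0, 25, 49, False, False, False),
   (30, 21, 17, 49, False, False, False),
   (19, 34, 6, 49, False, False, False),
   (29, 12, 5, 49, False, True, False),
   (12, 6, 1, 50, True, False, False),
   (27, 3, 21, 50, False, False, True),
   (34, 10, 16, 50, False, False, True),
   (31, 26, 20, 50, False, False, False),
   (22, 2, 18, 51, False, False, False),
   (5, 28, 13, 51, False, False, False),
   (30, 16, 10, 51, False, False, False),
   (8, 25, 35, 51, False, False, False),
   (0, 27, 24, 52, False, False, False),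
   (23, 8, 5, 52, False, False, False),
   (12, 18, 11, 52, False, False, False),
   (34, 30, 15, 52, False, False, False),
   (11, 7, 13, 53, False, False, False),
   (28, 31, 3, 53, False, False, False),
   (17, 26, 0, 53, False, False, False),
   (20, 33, 23, 53, False, False, False)]"

lemma gdd_1_36: "\<exists>Q. gdd 1 36 18 Q"
proof -
  have "\<exists>Q. gdd 1 (3 * 12) (3 * (18 - 12)) Q"
  \<comment> \<open>All outer points are fixed, and no quad is invariant.\<close>
  proof (rule gdd_1_rotations[where \<rho> = "\<lambda>n. 0 \<le> n \<and> n < 12" and Bs = base_36 and Fs = "[]" and ts = edge_tests])
    show "3 * (3 * length base_36 + length ([] :: (int \<times> int \<times> bool) list)) = 3 * 12 * (3 * 12 - 1)"
      by (simp add: base_36_def)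
  qed (force, force, code_simp, code_simp, code_simp, simp)
  then show ?thesis by simp
qed

section \<open>Orthogonal Latin squares of order \<open>4^i m\<close>\<close>

lemma latin_pairI:
  assumes "\<And>x y. x < r \<Longrightarrow> y < r \<Longrightarrow> f x y < r" "\<And>x y. x < r \<Longrightarrow> y < r \<Longrightarrow> h x y < r"
    and "\<And>x y x' y'. x < r \<Longrightarrow> y < r \<Longrightarrow> x' < r \<Longrightarrow> y' < r \<Longrightarrow>
      x = x' \<and> f x y = f x' y' \<or> x = x' \<and> h x y = h x' y' \<or>
      y = y' \<and> f x y = f x' y' \<or> y = y' \<and> h x y = h x' y' \<or> f x y = f x' y' \<and> h x y = h x' y' \<Longrightarrow>
      x = x' \<and> y = y'"
  shows "latin_pair r f h"
  unfolding latin_pair_def by (intro allI impI conjI[of "a < b" for a b] assms; assumption)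

text \<open>The squares \<open>x + y\<close> and \<open>x + 2y\<close> over the integers modulo
  \<open>r\<close> are orthogonal Latin squares as soon as the coefficients 1, 2 and their
  difference 1 are units; oddness supplies the unit 2.\<close>

lemma latin_pair_odd:
  assumes "odd r"
  shows "latin_pair r (\<lambda>x y. (x + y) mod r) (\<lambda>x y. (x + y + y) mod r)"
proof -
  have *: "a = b" if "[a = b] (mod r)" "a < r" "b < r" for a b
    using that by (simp add: cong_def)
  show ?thesis
  proof (rule latin_pairI, unfold cong_def[symmetric])
    fix x y x' y' :: nat
    assume b: "x < r" "y < r" "x' < r" "y' < r"
    assume "x = x' \<and> [x + y = x' + y'] (mod r) \<or> x = x' \<and> [x + y + y = x' + y' + y'] (mod r) \<or>
      y = y' \<and> [x + y = x' + y'] (mod r) \<or> y = y' \<and> [x + y + y = x' + y' + y'] (mod r) \<or>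
      [x + y = x' + y'] (mod r) \<and> [x + y + y = x' + y' + y'] (mod r)"
    then show "x = x' \<and> y = y'"
    proof (elim disjE conjE)
      assume "x = x'" "[x + y = x' + y'] (mod r)"
      then show ?thesis using * b by (simp add: cong_add_lcancel_nat)
    next
      assume h: "x = x'" "[x + y + y = x' + y' + y'] (mod r)"
      then have "[2 * y = 2 * y'] (mod r)" by (simp add: add.assoc cong_add_lcancel_nat mult_2)
      then have "[y = y'] (mod r)" using assms by (simp add: cong_mult_lcancel_nat)
      then show ?thesis using * b h by simp
    next
      assume "y = y'" "[x + y = x' + y'] (mod r)"
      then show ?thesis using * b by (simp add: cong_add_rcancel_nat)
    next
      assume "y = y'" "[x + y + y = x' + y' + y'] (mod r)"
      then show ?thesis using * b by (simp add: cong_add_rcancel_nat)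
    next
      assume h: "[x + y = x' + y'] (mod r)" "[x + y + y = x' + y' + y'] (mod r)"
      have "[x' + y' + y = x + y + y] (mod r)" using h(1) by (simp add: cong_add_rcancel_nat cong_sym)
      then have "[x' + y' + y = x' + y' + y'] (mod r)" using h(2) by (rule cong_trans)
      then have "y = y'" using * b by (simp add: cong_add_lcancel_nat)
      then show ?thesis using * b h(1) by (simp add: cong_add_rcancel_nat)
    qed
  qed (use assms in \<open>simp_all add: odd_pos\<close>)
qed

lemma latin_pair_iff_list_all:
  "latin_pair r f h \<longleftrightarrow> list_all (\<lambda>x. list_all (\<lambda>y. f x y < r \<and> h x y < r \<and>
    list_all (\<lambda>x'. list_all (\<lambda>y'. x = x' \<and> f x y = f x' y' \<or> x = x' \<and> h x y = h x' y' \<or>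
      y = y' \<and> f x y = f x' y' \<or> y = y' \<and> h x y = h x' y' \<or> f x y = f x' y' \<and> h x y = h x' y'
      \<longrightarrow> x = x' \<and> y = y') [0..<r]) [0..<r]) [0..<r]) [0..<r]"
  unfolding latin_pair_def by (simp only: list_all_iff set_upt Ball_def atLeastLessThan_iff le0 simp_thms)

text \<open>The tables of \<open>x + y\<close> and \<open>x + \<alpha>y\<close> over the field with four elements \<open>0, 1, \<alpha>, \<alpha> + 1\<close>.\<close>

lemma latin_pair_4:
  "latin_pair 4 (\<lambda>x y. [[0, 1, 2, 3], [1, 0, 3, 2], [2, 3, 0, 1], [3, 2, 1, 0]] ! x ! y)
     (\<lambda>x y. [[0, 2, 3, 1], [1, 3, 2, 0], [2, 0, 1, 3], [3, 1, 0, 2]] ! x ! y)"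
  unfolding latin_pair_iff_list_all by code_simp

text \<open>Repeated inflation takes the place of a product construction for Latin squares.\<close>

lemma gdd_inflate_4_odd:
  assumes "gdd g s q Q" "odd m"
  shows "\<exists>Q'. gdd (g * (4 ^ i * m)) s (q * (4 ^ i * m)) Q'"
proof (induction i)
  case 0
  then show ?case using gdd_inflate[OF assms(1) latin_pair_odd[OF assms(2)]] by simp
next
  case (Suc i)
  then obtain Q' where "gdd (g * (4 ^ i * m)) s (q * (4 ^ i * m)) Q'" by blast
  from gdd_inflate[OF this latin_pair_4] show ?case by (simp add: ac_simps)
qed

section \<open>The induction on \<open>t\<close>\<close>

text \<open>The groups of size 12 are inflated to size \<open>12 r\<close> and then filled. The
  \<open>6 (s - 1) r\<close> outer points of the inflation and the \<open>6 r\<close> of the filling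
  add up to \<open>6 r s\<close>.\<close>

lemma gdd_1_mult:
  assumes G: "\<exists>Q. gdd 12 s (6 * (s - 1)) Q" and D: "\<exists>Q. gdd 1 (12 * r) (6 * r) Q"
    and r: "r = 4 ^ i * m" "odd m" and "s > 0"
  shows "\<exists>Q. gdd 1 (12 * (r * s)) (6 * (r * s)) Q"
proof -
  obtain Q where "gdd (12 * r) s (6 * (s - 1) * r) Q"
    using G gdd_inflate_4_odd[OF _ r(2), of 12 s _ _ i] unfolding r(1) by blast
  moreover obtain Q' where "gdd 1 (12 * r) (6 * r) Q'" using D by blast
  ultimately have "\<exists>Q. gdd 1 (12 * r * s) (6 * (s - 1) * r + 6 * r) Q"
    by (rule gdd_fill) (use r in \<open>simp add: odd_pos\<close>)
  moreover have "6 * (s - 1) * r + 6 * r = 6 * (r * s)" using \<open>s > 0\<close> by (cases s) auto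
  ultimately show ?thesis by (simp add: mult.assoc)
qed

lemma obtain_4_power:
  assumes "t > (0 :: nat)"
  obtains i m where "odd m" "t = 4 ^ i * m" | i m where "odd m" "t = 2 * 4 ^ i * m"
proof -
  obtain m where m: "t = 2 ^ multiplicity 2 t * m" "odd m"
    using multiplicity_decompose'[of t 2] assms by auto
  show thesis
  proof (cases "even (multiplicity 2 t)")
    case True
    then obtain i where "multiplicity 2 t = 2 * i" by (elim evenE)
    then show thesis using m that(1)[of m i] by (simp add: power_mult)
  next
    case False
    then obtain i where "multiplicity 2 t = 2 * i + 1" by (elim oddE)
    then show thesis using m that(2)[of m i] by (simp add: power_mult)
  qed
qed

lemma coprime_6: "coprime m (6 :: nat)" if "odd m" "\<not> 3 dvd m"
proof -
  have "coprime m 3" using that(2) prime_imp_coprime[of 3 m] by (simp add: coprime_commute)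
  then have "coprime m (2 * 3)" using that(1) by (simp only: coprime_mult_right_iff coprime_right_2_iff_odd simp_thms)
  then show ?thesis by simp
qed

text \<open>The induction seeks a factorisation \<open>t = r * s\<close> where
  \<open>r = 4 ^ i * m\<close> with \<open>m\<close> odd is an available order of Latin squares, and
  \<open>s > 1\<close> is a number of groups of size 12 that is at hand. Then \<open>r < t\<close>,
  so the filling comes from the induction hypothesis. Only \<open>t = 2m\<close> with
  \<open>m\<close> coprime to 6 escapes this scheme.\<close>

lemma gdd_1_12_mult: "t > 0 \<Longrightarrow> \<exists>Q. gdd 1 (12 * t) (6 * t) Q"
proof (induction t rule: less_induct)
  case (less t)
  note IH = less.IH
  have step: ?case if G: "\<exists>Q. gdd 12 s (6 * (s - 1)) Q" and r: "t = 4 ^ i * m * s" "odd m" and "s > 1" for s i m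
  proof -
    let ?r = "4 ^ i * m"
    have "?r > 0" using r(2) by (simp add: odd_pos)
    then have "\<exists>Q. gdd 1 (12 * ?r) (6 * ?r) Q" using IH[of ?r] \<open>s > 1\<close> unfolding r(1) by simp
    then show ?thesis using gdd_1_mult[OF G _ refl r(2)] \<open>s > 1\<close> unfolding r(1) by simp
  qed
  consider "t = 1" | "t = 2" | "t = 3" | "t \<ge> 4" using less.prems by linarith
  then show ?case
  proof cases
    case 4
    from less.prems show ?thesis
    proof (cases rule: obtain_4_power)
      case (1 i m)
      show ?thesis
      proof (cases "i = 0")
        case False
        \<comment> \<open>One factor 4 becomes the number of groups.\<close>
        then show ?thesis using 1 gdd_12_4 by (intro step[of 4 "i - 1" m]) (auto simp: power_eq_if)
      next
        case True
        then have t: "t = m" using 1 by simp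
        show ?thesis
        proof (cases "3 dvd m")
          case False
          then show ?thesis
            using gdd_12_coprime_6[OF coprime_6[OF 1(1)]] 4 t by (intro step[of m 0 1]) auto
        next
          case True
          then obtain n where n: "m = 3 * n" by (elim dvdE)
          show ?thesis
          proof (cases "3 dvd n")
            case False
            \<comment> \<open>A single factor 3 is the inflation factor, and the groups of size 36
              are filled; \<open>n > 1\<close> because \<open>t >= 4\<close>.\<close>
            then show ?thesis
              using gdd_12_coprime_6[OF coprime_6, of n] 1 4 t n by (intro step[of n 0 3]) auto
          next
            case True
            then obtain k where "n = 3 * k" by (elim dvdE)
            then show ?thesis using 1 t n gdd_12_9 by (intro step[of 9 0 k]) auto
          qed
        qed
      qed
    next
      case (2 i m)
      show ?thesis
      proof (cases "3 dvd m")
        case True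
        then obtain n where "m = 3 * n" by (elim dvdE)
        \<comment> \<open>The unpaired factor 2 joins a factor 3 to give six groups.\<close>
        then show ?thesis using 2 gdd_12_6 by (intro step[of 6 i n]) auto
      next
        case False
        show ?thesis
        proof (cases "i = 0")
          case True
          \<comment> \<open>The factor 2 has no partner among the other factors and goes into the
            group size 24.\<close>
          then have t: "t = 2 * m" "m > 1" using 2 4 by auto
          obtain Q where "gdd 24 m (12 * (m - 1)) Q"
            using gdd_24_coprime_6[OF coprime_6[OF 2(1) False] t(2)] by blast
          moreover obtain Q' where "gdd 1 24 12 Q'" using gdd_1_24 by blast
          ultimately have "\<exists>Q. gdd 1 (24 * m) (12 * (m - 1) + 12) Q" by (rule gdd_fill) simp
          then show ?thesis using t by (simp add: diff_mult_distrib2)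
        next
          case False
          \<comment> \<open>The unpaired factor 2 joins a factor 4 to give eight groups.\<close>
          then show ?thesis using 2 gdd_12_8 by (intro step[of 8 "i - 1" m]) (auto simp: power_eq_if)
        qed
      qed
    qed
  qed (use gdd_1_12 gdd_1_24 gdd_1_36 in auto)
qed

theorem theorem4p7:
  fixes t :: nat
  assumes "t \<ge> 4"
  shows "(\<exists>(X :: nat set) (I :: nat set) B Y phi.
            finite I \<and> is_bibd X (image_mset B (mset_set I)) (12 * t) 3 2 \<and>
            strong_nesting X I B Y phi \<and> card Y = 18 * t)
       \<and> (\<forall>(X :: 'a set) (I :: 'i set) B Y phi.
            finite I \<and> is_bibd X (image_mset B (mset_set I)) (12 * t) 3 2 \<and>
            strong_nesting X I B Y phi \<longrightarrow> 18 * t \<le> card Y)"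
proof (intro conjI allI impI)
  obtain Q where "gdd 1 (12 * t) (6 * t) Q" using gdd_1_12_mult assms by force
  from gdd_imp_bibd[OF this] show "\<exists>(X :: nat set) (I :: nat set) B Y phi.
      finite I \<and> is_bibd X (image_mset B (mset_set I)) (12 * t) 3 2 \<and>
      strong_nesting X I B Y phi \<and> card Y = 18 * t" by simp
next
  fix X :: "'a set" and I :: "'i set" and B Y phi
  assume "finite I \<and> is_bibd X (image_mset B (mset_set I)) (12 * t) 3 2 \<and> strong_nesting X I B Y phi"
  \<comment> \<open>For \<open>v = 12 * t\<close> the bound reads
    \<open>36 * t <= 2 * card Y + 1\<close>, and parity removes the 1.\<close>
  then show "18 * t \<le> card Y" using strong_nesting_lower_bound[of I X B "12 * t" Y phi] assms by simp
qed

end
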